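(* As $n=2^k\to\infty$ over powers of $2$, the relaxation time of the edge-flip Markov chain $\mathcal{M}_k$ on dyadic tilings of size $n$ is at least $\Omega(n^{2\log\phi})$, where $\phi=\frac{\sqrt5+1}{2}$ is the golden ratio and $\log$ denotes the logarithm to base $2$.
   Context: A dyadic interval is an interval of the form $[a2^{-s},(a+1)2^{-s}]$ with $a,s$ non-negative integers and $0\le a<2^s$. A dyadic rectangle is the Cartesian product of two dyadic intervals. For $n=2^k$, a dyadic tiling of size $n$ is a tiling of the unit square $[0,1]^2$ by $n$ dyadic rectangles, each of area $1/n=2^{-k}$, that do not overlap except on their boundaries. $\Omega_k$ is the (finite) set of all dyadic tilings of size $2^k$. Edge-flip Markov chain $\mathcal{M}_k$ ($k\ge 1$, $n=2^k$) on state space $\Omega_k$: from the current tiling $\sigma_i$, choose a rectangle $R$ of $\sigma_i$ uniformly at random; choose left, right, top or bottom uniformly at random and let $e$ be the corresponding side of $R$. If $e$ bisects a rectangle of area $2^{-k+1}$ (i.e. $e$ is the common full side of two rectangles of $\sigma_i$ whose union is a rectangle), remove $e$ and replace it with its perpendicular bisector (so that this rectangle of area $2^{-k+1}$ is bisected in the other direction) to obtain $\sigma_{i+1}$, if the result is a valid dyadic tiling; otherwise set $\sigma_{i+1}=\sigma_i$. Equivalently, any two distinct tilings differing by one edge flip have transition probability $1/(2n)$ in each direction, all other off-diagonal transition probabilities are $0$, and the remaining mass is on the diagonal. The chain is lazy, irreducible and reversible, with uniform stationary distribution on $\Omega_k$. The spectral gap of a reversible transition matrix $P$ is $1-\lambda_2$,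 where $\lambda_2$ is its second largest eigenvalue; the relaxation time of a lazy chain is the inverse of its spectral gap. (The symbol $\Omega(\cdot)$ in the bound is the asymptotic lower-bound notation.) *)

theory Defs
  imports
    "HOL-Probability.Probability"
    "HOL-Library.Landau_Symbols"
    "Jordan_Normal_Form.Char_Poly"
begin

subsection \<open>Dyadic tilings of the unit square\<close>

definition dyadic_interval :: "real set \<Rightarrow> bool" where
  "dyadic_interval I \<longleftrightarrow>
     (\<exists>a s :: nat. a < 2 ^ s \<and> I = {real a / 2 ^ s .. (real a + 1) / 2 ^ s})"

definition dyadic_rectangle :: "(real \<times> real) set \<Rightarrow> bool" where
  "dyadic_rectangle R \<longleftrightarrow> (\<exists>I J. dyadic_interval I \<and> dyadic_interval J \<and> R = I \<times> J)"

text \<open>The relation \<open>division_of\<close> says that finitely many boxes with pairwise disjoint interiors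
  have the unit square as their union.\<close>

definition dyadic_tilings :: "nat \<Rightarrow> (real \<times> real) set set set" where
  "dyadic_tilings k = {T. T division_of ({0..1} \<times> {0..1}) \<and> card T = 2 ^ k \<and>
     (\<forall>R\<in>T. dyadic_rectangle R \<and> measure lborel R = 1 / 2 ^ k)}"

subsection \<open>The edge-flip chain\<close>

datatype direction = Left | Right | Top | Bottom

fun side :: "direction \<Rightarrow> (real \<times> real) set \<Rightarrow> (real \<times> real) set" where
  "side Left R = {p \<in> R. \<forall>q\<in>R. fst p \<le> fst q}"
| "side Right R = {p \<in> R. \<forall>q\<in>R. fst q \<le> fst p}"
| "side Top R = {p \<in> R. \<forall>q\<in>R. snd q \<le> snd p}"
| "side Bottom R = {p \<in> R. \<forall>q\<in>R. snd p \<le> snd q}"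

definition sides :: "(real \<times> real) set \<Rightarrow> (real \<times> real) set set" where
  "sides R = range (\<lambda>d. side d R)"

definition center :: "(real \<times> real) set \<Rightarrow> real \<times> real" where
  "center Q = midpoint (interval_lowerbound Q) (interval_upperbound Q)"

text \<open>The two halves of a rectangle \<open>Q\<close> cut perpendicularly to its bisecting edge: that edge is
  vertical if it is a left or right side of the rectangle from which it was chosen, and then
  \<open>Q\<close> is cut horizontally.\<close>

definition perpendicular_halves :: "direction \<Rightarrow> (real \<times> real) set \<Rightarrow> (real \<times> real) set set" where
  "perpendicular_halves d Q =
     (if d = Left \<or> d = Right
      then {{p \<in> Q. snd p \<le> snd (center Q)}, {p \<in> Q. snd (center Q) \<le> snd p}}
      else {{p \<in> Q. fst p \<le> fst (center Q)}, {p \<in> Q. fst (center Q) \<le> fst p}})"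

text \<open>In a tiling of size \<open>2 ^ k\<close>, two distinct rectangles having \<open>e\<close> as a full side lie on
  opposite sides of \<open>e\<close>, so their union is a rectangle of twice the area \<open>1 / 2 ^ k\<close>
  bisected by \<open>e\<close>.\<close>

definition edge_flip ::
  "nat \<Rightarrow> (real \<times> real) set set \<Rightarrow> (real \<times> real) set \<Rightarrow> direction \<Rightarrow> (real \<times> real) set set" where
  "edge_flip k T R d =
     (let e = side d R;
          A = {S \<in> T. e \<in> sides S};
          T' = (T - A) \<union> perpendicular_halves d (\<Union>A)
      in if card A = 2 \<and> T' \<in> dyadic_tilings k then T' else T)"

definition edge_flip_chain :: "nat \<Rightarrow> (real \<times> real) set set \<Rightarrow> (real \<times> real) set set pmf" where
  "edge_flip_chain k T =
     do { R \<leftarrow> pmf_of_set T;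
          d \<leftarrow> pmf_of_set {Left, Right, Top, Bottom};
          return_pmf (edge_flip k T R d) }"

subsection \<open>Relaxation time of a reversible chain on a finite state space\<close>

text \<open>The states of \<open>S\<close> are enumerated by \<open>from_nat_into S\<close>, which is a bijection from
  \<open>{..<card S}\<close> onto \<open>S\<close> for every finite \<open>S\<close>; the characteristic polynomial does not depend
  on the enumeration.\<close>

definition transition_matrix :: "'a set \<Rightarrow> ('a \<Rightarrow> 'a pmf) \<Rightarrow> real mat" where
  "transition_matrix S K =
     Matrix.mat (card S) (card S) (\<lambda>(i, j). pmf (K (from_nat_into S i)) (from_nat_into S j))"

text \<open>Eigenvalues in decreasing order, with multiplicity; for a reversible chain all of them
  are real.\<close>

definition eigenvalues_desc :: "real mat \<Rightarrow> real list" where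
  "eigenvalues_desc P = rev (sorted_list_of_multiset (proots (char_poly P)))"

definition spectral_gap :: "real mat \<Rightarrow> real" where
  "spectral_gap P = 1 - eigenvalues_desc P ! 1"

definition relaxation_time :: "real mat \<Rightarrow> real" where
  "relaxation_time P = 1 / spectral_gap P"

definition golden_ratio :: real where
  "golden_ratio = (sqrt 5 + 1) / 2"

end

theory Submission
  imports Defs
begin

text \<open>
  The lower bound is a bottleneck estimate. Let \<open>V\<close> be the set of tilings of size \<open>n = 2 ^ (k + 1)\<close>
  that the line \<open>x = 1/2\<close> cuts into two tilings of its halves. Every tiling is cut
  in this way by \<open>x = 1/2\<close> or by \<open>y = 1/2\<close>. A flip leads out of \<open>V\<close> only if it merges two rectangles
  \<open>[0, 1/2] \<times> J\<close> and \<open>[1/2, 1] \<times> J\<close> with \<open>|J| = 2 ^ -k\<close>. Hence each half of the tiling, rescaled to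
  the unit square, is a tiling of size \<open>2 ^ k\<close> containing the row \<open>[0, 1] \<times> J\<close>.

  With \<open>a k\<close> the number of tilings of size \<open>2 ^ k\<close>, inclusion-exclusion over the two cuts gives
  \<open>a (k + 2) \<ge> 2 a (k + 1)\<^sup>2 - a k ^ 4\<close>. As the golden ratio \<open>\<phi>\<close> satisfies \<open>2 - 1 / \<phi>\<^sup>2 = \<phi>\<close>, induction
  yields \<open>\<phi> a k\<^sup>2 \<le> a (k + 1)\<close> (\<open>num_tilings_Suc_ge\<close>). A tiling with a given row is cut horizontally at
  each of the \<open>k\<close> scales around this row, so at most \<open>a k / \<phi> ^ k\<close> tilings contain it
  (\<open>card_tilings_with_row\<close>). Both halves must contain the row and there are \<open>2 ^ k\<close> choices of \<open>J\<close>, so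
  the flow out of \<open>V\<close> is at most of order \<open>a k\<^sup>2 / \<phi> ^ (2 k)\<close> (\<open>vcut_flow\<close>), whereas \<open>V\<close> has \<open>a k\<^sup>2\<close>
  elements and at least a constant proportion of all tilings lie outside it. Testing the gap with the
  centred indicator of \<open>V\<close> bounds it by a multiple of \<open>\<phi> ^ (-2 k)\<close>, which is of order
  \<open>n powr (- 2 log 2 \<phi>)\<close>.

  The variational bound needs care with the definition of the gap through the sorted list of roots of
  the characteristic polynomial. For a connected symmetric walk \<open>1\<close> is a simple root, all
  roots are at most \<open>1\<close>, and the maximum of the Rayleigh quotient over vectors of sum zero is attained at an
  eigenvector (\<open>spectral_gap_bounds\<close>). Connectedness of the flip graph is also what makes the gap
  positive, so that its inverse is not the default value \<open>0\<close>.

  Tilings are handled as sets of pairs of binary words, one word for each dyadic interval. The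
  description of these sets by recursion on the cuts is matched with the geometric definition
  in \<open>dyadic_tilings_eq\<close>.
\<close>

section \<open>Tilings as sets of pairs of binary words\<close>

text \<open>A word stands for the dyadic interval reached from \<open>[0, 1]\<close> by taking successive left
  (\<open>False\<close>) and right (\<open>True\<close>) halves; a tile is the product of the intervals of two words.\<close>

type_synonym tile = "bool list \<times> bool list"

text \<open>Two tilings of the unit square are squeezed into its left and right halves.\<close>

definition vjoin :: "tile set \<Rightarrow> tile set \<Rightarrow> tile set" where
  "vjoin T\<^sub>0 T\<^sub>1 = map_prod (Cons False) id ` T\<^sub>0 \<union> map_prod (Cons True) id ` T\<^sub>1"

text \<open>The same for the lower and upper halves.\<close>

definition hjoin :: "tile set \<Rightarrow> tile set \<Rightarrow> tile set" where
  "hjoin T\<^sub>0 T\<^sub>1 = map_prod id (Cons False) ` T\<^sub>0 \<union> map_prod id (Cons True) ` T\<^sub>1"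

text \<open>The tilings by tiles of area \<open>1 / 2 ^ k\<close>; a tiling that is cut along both midlines
  arises in both ways.\<close>

primrec tilings :: "nat \<Rightarrow> tile set set" where
  "tilings 0 = {{([], [])}}"
| "tilings (Suc k) = case_prod vjoin ` (tilings k \<times> tilings k) \<union> case_prod hjoin ` (tilings k \<times> tilings k)"

declare tilings.simps(2) [simp del]

lemma mem_vjoin [simp]:
  "([], q) \<notin> vjoin T\<^sub>0 T\<^sub>1"
  "(b # p, q) \<in> vjoin T\<^sub>0 T\<^sub>1 \<longleftrightarrow> (p, q) \<in> (if b then T\<^sub>1 else T\<^sub>0)"
  by (force simp: vjoin_def)+

lemma mem_hjoin [simp]:
  "(p, []) \<notin> hjoin T\<^sub>0 T\<^sub>1"
  "(p, b # q) \<in> hjoin T\<^sub>0 T\<^sub>1 \<longleftrightarrow> (p, q) \<in> (if b then T\<^sub>1 else T\<^sub>0)"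
  by (force simp: hjoin_def)+

lemma vjoin_eq_iff [simp]: "vjoin S\<^sub>0 S\<^sub>1 = vjoin T\<^sub>0 T\<^sub>1 \<longleftrightarrow> S\<^sub>0 = T\<^sub>0 \<and> S\<^sub>1 = T\<^sub>1"
proof
  assume eq: "vjoin S\<^sub>0 S\<^sub>1 = vjoin T\<^sub>0 T\<^sub>1"
  have "x \<in> S\<^sub>0 \<longleftrightarrow> x \<in> T\<^sub>0" "x \<in> S\<^sub>1 \<longleftrightarrow> x \<in> T\<^sub>1" for x
    using arg_cong[OF eq, of "\<lambda>T. (False # fst x, snd x) \<in> T"]
      arg_cong[OF eq, of "\<lambda>T. (True # fst x, snd x) \<in> T"] by simp_all
  then show "S\<^sub>0 = T\<^sub>0 \<and> S\<^sub>1 = T\<^sub>1" by auto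
qed simp

lemma hjoin_eq_iff [simp]: "hjoin S\<^sub>0 S\<^sub>1 = hjoin T\<^sub>0 T\<^sub>1 \<longleftrightarrow> S\<^sub>0 = T\<^sub>0 \<and> S\<^sub>1 = T\<^sub>1"
proof
  assume eq: "hjoin S\<^sub>0 S\<^sub>1 = hjoin T\<^sub>0 T\<^sub>1"
  have "x \<in> S\<^sub>0 \<longleftrightarrow> x \<in> T\<^sub>0" "x \<in> S\<^sub>1 \<longleftrightarrow> x \<in> T\<^sub>1" for x
    using arg_cong[OF eq, of "\<lambda>T. (fst x, False # snd x) \<in> T"]
      arg_cong[OF eq, of "\<lambda>T. (fst x, True # snd x) \<in> T"] by simp_all
  then show "S\<^sub>0 = T\<^sub>0 \<and> S\<^sub>1 = T\<^sub>1" by auto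
qed simp

lemma vjoin_hjoin:
  "vjoin (hjoin T\<^sub>0 T\<^sub>1) (hjoin T\<^sub>2 T\<^sub>3) = hjoin (vjoin T\<^sub>0 T\<^sub>2) (vjoin T\<^sub>1 T\<^sub>3)"
  by (simp add: vjoin_def hjoin_def image_Un image_image map_prod_def case_prod_beta Un_ac)

lemma tilings_SucE:
  assumes "T \<in> tilings (Suc k)"
  obtains T\<^sub>0 T\<^sub>1 where "T = vjoin T\<^sub>0 T\<^sub>1" "T\<^sub>0 \<in> tilings k" "T\<^sub>1 \<in> tilings k"
  | T\<^sub>0 T\<^sub>1 where "T = hjoin T\<^sub>0 T\<^sub>1" "T\<^sub>0 \<in> tilings k" "T\<^sub>1 \<in> tilings k"
  using assms by (auto simp: tilings.simps(2))

lemma joins_in_tilings: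
  assumes "T\<^sub>0 \<in> tilings k" "T\<^sub>1 \<in> tilings k"
  shows "vjoin T\<^sub>0 T\<^sub>1 \<in> tilings (Suc k)" "hjoin T\<^sub>0 T\<^sub>1 \<in> tilings (Suc k)"
  using assms by (auto simp: tilings.simps(2))

lemma finite_tilings: "finite (tilings k)"
  by (induction k) (auto simp: tilings.simps(2))

lemma tilings_nonempty: "tilings k \<noteq> {}"
  by (induction k) (auto simp: tilings.simps(2))

lemma card_vjoin:
  assumes "finite T\<^sub>0" "finite T\<^sub>1"
  shows "card (vjoin T\<^sub>0 T\<^sub>1) = card T\<^sub>0 + card T\<^sub>1"
proof -
  have "card (map_prod (Cons b) id ` S) = card S" for b and S :: "tile set"
    by (rule card_image) (auto simp: inj_on_def)
  then show ?thesis
    unfolding vjoin_def using assms by (subst card_Un_disjoint) auto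
qed

lemma card_hjoin:
  assumes "finite T\<^sub>0" "finite T\<^sub>1"
  shows "card (hjoin T\<^sub>0 T\<^sub>1) = card T\<^sub>0 + card T\<^sub>1"
proof -
  have "card (map_prod id (Cons b) ` S) = card S" for b and S :: "tile set"
    by (rule card_image) (auto simp: inj_on_def)
  then show ?thesis
    unfolding hjoin_def using assms by (subst card_Un_disjoint) auto
qed

lemma finite_joins:
  "finite (vjoin T\<^sub>0 T\<^sub>1) \<longleftrightarrow> finite T\<^sub>0 \<and> finite T\<^sub>1"
  "finite (hjoin T\<^sub>0 T\<^sub>1) \<longleftrightarrow> finite T\<^sub>0 \<and> finite T\<^sub>1"
proof -
  have "inj_on (map_prod (Cons b) id) S" "inj_on (map_prod id (Cons b)) S"
    for b and S :: "tile set"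
    by (auto simp: inj_on_def)
  then show "finite (vjoin T\<^sub>0 T\<^sub>1) \<longleftrightarrow> finite T\<^sub>0 \<and> finite T\<^sub>1"
    "finite (hjoin T\<^sub>0 T\<^sub>1) \<longleftrightarrow> finite T\<^sub>0 \<and> finite T\<^sub>1"
    by (simp_all add: vjoin_def hjoin_def finite_image_iff)
qed

lemma finite_card_tiling:
  assumes "T \<in> tilings k"
  shows "finite T \<and> card T = 2 ^ k"
  using assms
proof (induction k arbitrary: T)
  case (Suc k)
  from Suc.prems show ?case
    by (cases rule: tilings_SucE) (use Suc.IH in \<open>simp_all add: card_vjoin card_hjoin finite_joins\<close>)
qed simp

lemma length_tiling:
  assumes "T \<in> tilings k" "(p, q) \<in> T"
  shows "length p + length q = k"
  using assms
proof (induction k arbitrary: T p q)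
  case (Suc k)
  from Suc.prems(1) show ?case
  proof (cases rule: tilings_SucE)
    case (1 T\<^sub>0 T\<^sub>1)
    then show ?thesis
      using Suc.prems(2) Suc.IH[of T\<^sub>0] Suc.IH[of T\<^sub>1] by (auto simp: vjoin_def)
  next
    case (2 T\<^sub>0 T\<^sub>1)
    then show ?thesis
      using Suc.prems(2) Suc.IH[of T\<^sub>0] Suc.IH[of T\<^sub>1] by (auto simp: hjoin_def)
  qed
qed simp

text \<open>A tiling without a tile of full height is cut by the line \<open>y = 1/2\<close>. If it is cut by \<open>x = 1/2\<close>
  as well, both halves inherit the property, and the two cuts can be exchanged.\<close>

lemma hjoin_if_no_full_height:
  assumes "T \<in> tilings (Suc k)" "\<And>p. (p, []) \<notin> T"
  shows "\<exists>T\<^sub>0\<in>tilings k. \<exists>T\<^sub>1\<in>tilings k. T = hjoin T\<^sub>0 T\<^sub>1"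
  using assms
proof (induction k arbitrary: T)
  case 0
  then have "T = vjoin {([], [])} {([], [])} \<or> T = hjoin {([], [])} {([], [])}"
    by (auto simp: tilings.simps(2))
  moreover have "([False], []) \<in> vjoin {([], [])} {([], [])}" by simp
  ultimately have "T = hjoin {([], [])} {([], [])}" using 0(2) by metis
  then show ?case by simp
next
  case (Suc k)
  from Suc.prems(1) show ?case
  proof (cases rule: tilings_SucE)
    case (1 S T')
    have "(p, []) \<notin> S" "(p, []) \<notin> T'" for p
      using Suc.prems(2)[of "False # p"] Suc.prems(2)[of "True # p"] 1(1) by simp_all
    then obtain S\<^sub>0 S\<^sub>1 T\<^sub>0 T\<^sub>1 where "S = hjoin S\<^sub>0 S\<^sub>1" "T' = hjoin T\<^sub>0 T\<^sub>1"
      "S\<^sub>0 \<in> tilings k" "S\<^sub>1 \<in> tilings k" "T\<^sub>0 \<in> tilings k" "T\<^sub>1 \<in> tilings k"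
      using Suc.IH[OF 1(2)] Suc.IH[OF 1(3)] by blast
    then show ?thesis using 1(1) joins_in_tilings by (metis vjoin_hjoin)
  qed auto
qed

lemma swap_vjoin: "prod.swap ` vjoin S T = hjoin (prod.swap ` S) (prod.swap ` T)"
  and swap_hjoin: "prod.swap ` hjoin S T = vjoin (prod.swap ` S) (prod.swap ` T)"
  by (simp_all add: vjoin_def hjoin_def image_Un image_image prod.case_eq_if map_prod_def)

lemma swap_tiling: "T \<in> tilings k \<Longrightarrow> prod.swap ` T \<in> tilings k"
proof (induction k arbitrary: T)
  case (Suc k)
  from Suc.prems show ?case
    by (cases rule: tilings_SucE)
      (simp_all only: swap_vjoin swap_hjoin joins_in_tilings Suc.IH)
qed simp

lemma vjoin_if_no_full_width:
  assumes "T \<in> tilings (Suc k)" "\<And>q. ([], q) \<notin> T"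
  shows "\<exists>T\<^sub>0\<in>tilings k. \<exists>T\<^sub>1\<in>tilings k. T = vjoin T\<^sub>0 T\<^sub>1"
proof -
  have "(p, []) \<notin> prod.swap ` T" for p using assms(2) by auto
  then obtain T\<^sub>0 T\<^sub>1 where "T\<^sub>0 \<in> tilings k" "T\<^sub>1 \<in> tilings k" "prod.swap ` T = hjoin T\<^sub>0 T\<^sub>1"
    using hjoin_if_no_full_height[OF swap_tiling[OF assms(1)]] by blast
  moreover from this(3) have "prod.swap ` (prod.swap ` T) = vjoin (prod.swap ` T\<^sub>0) (prod.swap ` T\<^sub>1)"
    by (simp add: swap_hjoin)
  then have "T = vjoin (prod.swap ` T\<^sub>0) (prod.swap ` T\<^sub>1)" by (simp add: image_image)
  ultimately show ?thesis using swap_tiling by blast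
qed

section \<open>Counting tilings\<close>

abbreviation num_tilings :: "nat \<Rightarrow> real" where
  "num_tilings k \<equiv> real (card (tilings k))"

text \<open>The tilings that are cut by the line \<open>x = 1/2\<close>, respectively \<open>y = 1/2\<close>. The parameter \<open>k\<close> refers to the
  two pieces, so that the whole tiling has size \<open>2 ^ Suc k\<close>.\<close>

definition vcut :: "nat \<Rightarrow> tile set set" where
  "vcut k = case_prod vjoin ` (tilings k \<times> tilings k)"

definition hcut :: "nat \<Rightarrow> tile set set" where
  "hcut k = case_prod hjoin ` (tilings k \<times> tilings k)"

lemma tilings_Suc: "tilings (Suc k) = vcut k \<union> hcut k"
  by (simp add: vcut_def hcut_def tilings.simps(2))

lemma card_vcut: "card (vcut k) = card (tilings k) ^ 2"
  unfolding vcut_def by (subst card_image) (auto simp: inj_on_def power2_eq_square card_cartesian_product)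

lemma card_hcut: "card (hcut k) = card (tilings k) ^ 2"
  unfolding hcut_def by (subst card_image) (auto simp: inj_on_def power2_eq_square card_cartesian_product)

lemma finite_cuts: "finite (vcut k)" "finite (hcut k)"
  by (auto simp: vcut_def hcut_def finite_tilings)

lemma no_full_height_if_hcut: "T \<in> hcut k \<Longrightarrow> (p, []) \<notin> T"
  by (auto simp: hcut_def)

lemma no_full_width_if_vcut: "T \<in> vcut k \<Longrightarrow> ([], q) \<notin> T"
  by (auto simp: vcut_def)

lemma vcut_Int_hcut_subset:
  "vcut (Suc k) \<inter> hcut (Suc k) \<subseteq> case_prod vjoin ` (hcut k \<times> hcut k)"
proof
  fix T assume T: "T \<in> vcut (Suc k) \<inter> hcut (Suc k)"
  then obtain T\<^sub>0 T\<^sub>1 where eq: "T = vjoin T\<^sub>0 T\<^sub>1" and mem: "T\<^sub>0 \<in> tilings (Suc k)" "T\<^sub>1 \<in> tilings (Suc k)"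
    by (auto simp: vcut_def)
  have "(p, []) \<notin> T\<^sub>0" "(p, []) \<notin> T\<^sub>1" for p
    using no_full_height_if_hcut[of T "Suc k" "False # p"]
      no_full_height_if_hcut[of T "Suc k" "True # p"] T eq by auto
  then have "T\<^sub>0 \<in> hcut k" "T\<^sub>1 \<in> hcut k"
    using hjoin_if_no_full_height mem unfolding hcut_def by blast+
  then show "T \<in> case_prod vjoin ` (hcut k \<times> hcut k)" using eq by auto
qed

lemma vcut_Int_hcut_0: "vcut 0 \<inter> hcut 0 = {}"
proof -
  have "([False], []) \<in> vjoin {([], [])} {([], [])}" "([False], []) \<notin> hjoin {([], [])} {([], [])}" by simp_all
  then have "vjoin {([], [])} {([], [])} \<noteq> hjoin {([], [])} {([], [])}" by metis
  then show ?thesis unfolding vcut_def hcut_def by auto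
qed

lemma golden_ratio_square: "golden_ratio ^ 2 = golden_ratio + 1"
  by (simp add: golden_ratio_def power2_eq_square field_simps)

lemma golden_ratio_gt_1: "golden_ratio > 1"
proof -
  have "1 < sqrt 5" by (rule real_less_rsqrt) simp
  then show ?thesis by (simp add: golden_ratio_def)
qed

lemma num_tilings_Suc_ge: "golden_ratio * num_tilings k ^ 2 \<le> num_tilings (Suc k)"
proof (induction k)
  case 0
  have "sqrt 5 \<le> 3" by (rule real_le_lsqrt) simp_all
  then have "golden_ratio \<le> 2" by (simp add: golden_ratio_def)
  moreover have "card (tilings (Suc 0)) = 2"
    unfolding tilings_Suc using vcut_Int_hcut_0
    by (subst card_Un_disjoint) (auto simp: finite_cuts card_vcut card_hcut)
  ultimately show ?case by simp
next
  case (Suc k)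
  let ?a = "num_tilings k" and ?b = "num_tilings (Suc k)"
  have "card (vcut (Suc k) \<inter> hcut (Suc k)) \<le> card (case_prod vjoin ` (hcut k \<times> hcut k))"
    by (rule card_mono[OF _ vcut_Int_hcut_subset]) (simp add: finite_cuts)
  also have "\<dots> \<le> card (hcut k \<times> hcut k)"
    by (rule card_image_le) (simp add: finite_cuts)
  also have "\<dots> = card (tilings k) ^ 4"
    by (simp add: card_hcut card_cartesian_product power4_eq_xxxx power2_eq_square)
  finally have int: "real (card (vcut (Suc k) \<inter> hcut (Suc k))) \<le> ?a ^ 4" 
    by (simp flip: of_nat_power)
  have "card (vcut (Suc k)) + card (hcut (Suc k)) =
      card (tilings (Suc (Suc k))) + card (vcut (Suc k) \<inter> hcut (Suc k))"
    unfolding tilings_Suc[of "Suc k"] by (rule card_Un_Int) (simp_all add: finite_cuts)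
  then have sum: "2 * ?b ^ 2 = num_tilings (Suc (Suc k)) + real (card (vcut (Suc k) \<inter> hcut (Suc k)))"
    unfolding card_vcut card_hcut by (simp flip: of_nat_power of_nat_add)
  \<comment> \<open>The induction hypothesis bounds the number of tilings cut along both midlines; the two factors
    cancel because \<open>golden_ratio\<^sup>2 * (2 - golden_ratio) = 1\<close>.\<close>
  have "golden_ratio ^ 2 * ?a ^ 4 = (golden_ratio * ?a ^ 2) ^ 2"
    by (simp add: power_mult_distrib flip: power_mult)
  also have "\<dots> \<le> ?b ^ 2"
    using Suc golden_ratio_gt_1 by (intro power_mono) auto
  finally have *: "golden_ratio ^ 2 * ?a ^ 4 \<le> ?b ^ 2" .
  have "(golden_ratio + 1) * (2 - golden_ratio) = golden_ratio + 2 - golden_ratio ^ 2"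
    by (simp add: algebra_simps power2_eq_square)
  then have "golden_ratio ^ 2 * (2 - golden_ratio) = 1"
    by (simp add: golden_ratio_square)
  then have "golden_ratio ^ 2 * ((2 - golden_ratio) * ?b ^ 2) = ?b ^ 2"
    unfolding mult.assoc[symmetric] by simp
  then have "golden_ratio ^ 2 * ?a ^ 4 \<le> golden_ratio ^ 2 * ((2 - golden_ratio) * ?b ^ 2)"
    using * by (simp only:)
  then have "?a ^ 4 \<le> (2 - golden_ratio) * ?b ^ 2"
    using golden_ratio_gt_1 by simp
  then show ?case using sum int unfolding left_diff_distrib by linarith
qed

text \<open>A tiling with a tile of full width is cut by \<open>y = 1/2\<close>, and the tile is a row of one of the two
  pieces while the other piece is arbitrary. Each of the \<open>k\<close> steps costs a factor \<open>golden_ratio\<close>.\<close>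

lemma card_tilings_with_row:
  assumes "length q = k"
  shows "golden_ratio ^ k * real (card {T \<in> tilings k. ([], q) \<in> T}) \<le> num_tilings k"
  using assms
proof (induction k arbitrary: q)
  case 0
  then have "{T \<in> tilings 0. ([], q) \<in> T} = {{([], [])}}" by auto
  then show ?case by simp
next
  case (Suc k)
  then obtain b r where q: "q = b # r" "length r = k" by (cases q) auto
  let ?S = "{T \<in> tilings k. ([], r) \<in> T}"
  let ?P = "if b then tilings k \<times> ?S else ?S \<times> tilings k"
  have "{T \<in> tilings (Suc k). ([], q) \<in> T} \<subseteq> case_prod hjoin ` ?P"
  proof
    fix T assume "T \<in> {T \<in> tilings (Suc k). ([], q) \<in> T}"
    then have T: "T \<in> tilings (Suc k)" "([], q) \<in> T" by auto
    from T(1) show "T \<in> case_prod hjoin ` ?P"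
      by (cases rule: tilings_SucE) (use T(2) q in \<open>auto split: if_splits\<close>)
  qed
  then have "card {T \<in> tilings (Suc k). ([], q) \<in> T} \<le> card (case_prod hjoin ` ?P)"
    by (rule card_mono[rotated]) (auto simp: finite_tilings)
  also have "\<dots> \<le> card ?P"
    by (rule card_image_le) (auto simp: finite_tilings)
  also have "\<dots> = card ?S * card (tilings k)"
    by (auto simp: card_cartesian_product)
  finally have "real (card {T \<in> tilings (Suc k). ([], q) \<in> T}) \<le> real (card ?S) * num_tilings k"
    by (simp flip: of_nat_mult)
  then have "golden_ratio ^ Suc k * real (card {T \<in> tilings (Suc k). ([], q) \<in> T})
      \<le> golden_ratio ^ Suc k * (real (card ?S) * num_tilings k)"
    using golden_ratio_gt_1 by (intro mult_left_mono) auto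
  also have "\<dots> = golden_ratio * (golden_ratio ^ k * real (card ?S)) * num_tilings k"
    by simp
  also have "\<dots> \<le> golden_ratio * num_tilings k * num_tilings k"
    using Suc.IH[OF q(2)] golden_ratio_gt_1 by (intro mult_right_mono mult_left_mono) auto
  also have "\<dots> \<le> num_tilings (Suc k)"
    using num_tilings_Suc_ge[of k] by (simp add: power2_eq_square mult.assoc)
  finally show ?case .
qed

section \<open>Flips and connectedness\<close>

text \<open>The tilings agree outside one rectangle \<open>(p, q)\<close> of area twice that of a tile, which \<open>T\<close> bisects by
  a vertical and \<open>T'\<close> by a horizontal edge.\<close>

definition vflip :: "tile set \<Rightarrow> tile set \<Rightarrow> bool" where
  "vflip T T' \<longleftrightarrow> (\<exists>X p q.
     T = X \<union> {(p @ [False], q), (p @ [True], q)} \<and> T' = X \<union> {(p, q @ [False]), (p, q @ [True])} \<and>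
     X \<inter> {(p @ [False], q), (p @ [True], q), (p, q @ [False]), (p, q @ [True])} = {})"

lemma vflipE:
  assumes "vflip T T'"
  obtains X p q where
    "T = X \<union> {(p @ [False], q), (p @ [True], q)}" "T' = X \<union> {(p, q @ [False]), (p, q @ [True])}"
    "X \<inter> {(p @ [False], q), (p @ [True], q), (p, q @ [False]), (p, q @ [True])} = {}"
  using assms unfolding vflip_def by (elim exE conjE) (rule that)

text \<open>Adjacency in the flip graph.\<close>

definition flip_rel :: "nat \<Rightarrow> (tile set \<times> tile set) set" where
  "flip_rel k = {(T, T'). T \<in> tilings k \<and> T' \<in> tilings k \<and> (vflip T T' \<or> vflip T' T)}"

lemma vjoin_Un: "vjoin (S \<union> S') T = vjoin S T \<union> vjoin S' {}" "vjoin S (T \<union> T') = vjoin S T \<union> vjoin {} T'"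
  and hjoin_Un: "hjoin (S \<union> S') T = hjoin S T \<union> hjoin S' {}" "hjoin S (T \<union> T') = hjoin S T \<union> hjoin {} T'"
  by (simp_all add: vjoin_def hjoin_def image_Un Un_ac)

lemma vflip_vjoin:
  assumes "vflip T T'"
  shows "vflip (vjoin T S) (vjoin T' S)" "vflip (vjoin S T) (vjoin S T')"
proof -
  obtain X p q where X: "T = X \<union> {(p @ [False], q), (p @ [True], q)}"
    "T' = X \<union> {(p, q @ [False]), (p, q @ [True])}"
    "X \<inter> {(p @ [False], q), (p @ [True], q), (p, q @ [False]), (p, q @ [True])} = {}"
    using assms by (rule vflipE)
  show "vflip (vjoin T S) (vjoin T' S)"
    unfolding vflip_def
    by (rule exI[of _ "vjoin X S"], rule exI[of _ "False # p"], rule exI[of _ "q"])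
      (use X(3) in \<open>simp add: X(1,2) vjoin_Un del: Un_insert_right, auto simp: vjoin_def\<close>)
  show "vflip (vjoin S T) (vjoin S T')"
    unfolding vflip_def
    by (rule exI[of _ "vjoin S X"], rule exI[of _ "True # p"], rule exI[of _ "q"])
      (use X(3) in \<open>simp add: X(1,2) vjoin_Un del: Un_insert_right, auto simp: vjoin_def\<close>)
qed

lemma vflip_hjoin:
  assumes "vflip T T'"
  shows "vflip (hjoin T S) (hjoin T' S)" "vflip (hjoin S T) (hjoin S T')"
proof -
  obtain X p q where X: "T = X \<union> {(p @ [False], q), (p @ [True], q)}"
    "T' = X \<union> {(p, q @ [False]), (p, q @ [True])}"
    "X \<inter> {(p @ [False], q), (p @ [True], q), (p, q @ [False]), (p, q @ [True])} = {}"
    using assms by (rule vflipE)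
  show "vflip (hjoin T S) (hjoin T' S)"
    unfolding vflip_def
    by (rule exI[of _ "hjoin X S"], rule exI[of _ "p"], rule exI[of _ "False # q"])
      (use X(3) in \<open>simp add: X(1,2) hjoin_Un del: Un_insert_right, auto simp: hjoin_def\<close>)
  show "vflip (hjoin S T) (hjoin S T')"
    unfolding vflip_def
    by (rule exI[of _ "hjoin S X"], rule exI[of _ "p"], rule exI[of _ "True # q"])
      (use X(3) in \<open>simp add: X(1,2) hjoin_Un del: Un_insert_right, auto simp: hjoin_def\<close>)
qed

lemma rtrancl_image:
  assumes "(x, y) \<in> R\<^sup>*" "\<And>x y. (x, y) \<in> R \<Longrightarrow> (f x, f y) \<in> S"
  shows "(f x, f y) \<in> S\<^sup>*"
  using assms(1) by induction (auto intro: rtrancl_into_rtrancl assms(2))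

lemma flip_rel_joins:
  assumes "(T, T') \<in> flip_rel k" "S \<in> tilings k"
  shows "(vjoin T S, vjoin T' S) \<in> flip_rel (Suc k)" "(vjoin S T, vjoin S T') \<in> flip_rel (Suc k)"
    "(hjoin T S, hjoin T' S) \<in> flip_rel (Suc k)" "(hjoin S T, hjoin S T') \<in> flip_rel (Suc k)"
  using assms unfolding flip_rel_def
  by (auto simp: joins_in_tilings dest: vflip_vjoin[of _ _ S] vflip_hjoin[of _ _ S])

text \<open>By induction the pieces of a tiling can be changed arbitrarily, so all tilings cut by \<open>x = 1/2\<close>
  are connected to each other, and likewise for \<open>y = 1/2\<close>. The two classes share a tiling cut along
  both midlines, except that for two tiles they are joined by a single flip.\<close>

lemma flip_rel_connected:
  assumes "T \<in> tilings k" "T' \<in> tilings k"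
  shows "(T, T') \<in> (flip_rel k)\<^sup>*"
  using assms
proof (induction k arbitrary: T T')
  case (Suc k)
  have v: "(S, S') \<in> (flip_rel (Suc k))\<^sup>*" if S: "S \<in> vcut k" "S' \<in> vcut k" for S S'
  proof -
    obtain S\<^sub>0 S\<^sub>1 S\<^sub>0' S\<^sub>1' where eq: "S = vjoin S\<^sub>0 S\<^sub>1" "S' = vjoin S\<^sub>0' S\<^sub>1'"
      and mem: "S\<^sub>0 \<in> tilings k" "S\<^sub>1 \<in> tilings k" "S\<^sub>0' \<in> tilings k" "S\<^sub>1' \<in> tilings k"
      using S unfolding vcut_def by auto
    have "(vjoin S\<^sub>0 S\<^sub>1, vjoin S\<^sub>0' S\<^sub>1) \<in> (flip_rel (Suc k))\<^sup>*"
      by (rule rtrancl_image[where f = "\<lambda>X. vjoin X S\<^sub>1", OF Suc.IH[OF mem(1,3)]])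
        (rule flip_rel_joins(1)[OF _ mem(2)])
    also have "(vjoin S\<^sub>0' S\<^sub>1, vjoin S\<^sub>0' S\<^sub>1') \<in> (flip_rel (Suc k))\<^sup>*"
      by (rule rtrancl_image[where f = "\<lambda>X. vjoin S\<^sub>0' X", OF Suc.IH[OF mem(2,4)]])
        (rule flip_rel_joins(2)[OF _ mem(3)])
    finally show ?thesis unfolding eq .
  qed
  have h: "(S, S') \<in> (flip_rel (Suc k))\<^sup>*" if S: "S \<in> hcut k" "S' \<in> hcut k" for S S'
  proof -
    obtain S\<^sub>0 S\<^sub>1 S\<^sub>0' S\<^sub>1' where eq: "S = hjoin S\<^sub>0 S\<^sub>1" "S' = hjoin S\<^sub>0' S\<^sub>1'"
      and mem: "S\<^sub>0 \<in> tilings k" "S\<^sub>1 \<in> tilings k" "S\<^sub>0' \<in> tilings k" "S\<^sub>1' \<in> tilings k"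
      using S unfolding hcut_def by auto
    have "(hjoin S\<^sub>0 S\<^sub>1, hjoin S\<^sub>0' S\<^sub>1) \<in> (flip_rel (Suc k))\<^sup>*"
      by (rule rtrancl_image[where f = "\<lambda>X. hjoin X S\<^sub>1", OF Suc.IH[OF mem(1,3)]])
        (rule flip_rel_joins(3)[OF _ mem(2)])
    also have "(hjoin S\<^sub>0' S\<^sub>1, hjoin S\<^sub>0' S\<^sub>1') \<in> (flip_rel (Suc k))\<^sup>*"
      by (rule rtrancl_image[where f = "\<lambda>X. hjoin S\<^sub>0' X", OF Suc.IH[OF mem(2,4)]])
        (rule flip_rel_joins(4)[OF _ mem(3)])
    finally show ?thesis unfolding eq .
  qed
  obtain V H where VH: "V \<in> vcut k" "H \<in> hcut k"
    "(V, H) \<in> (flip_rel (Suc k))\<^sup>*" "(H, V) \<in> (flip_rel (Suc k))\<^sup>*"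
  proof (cases k)
    case 0
    let ?V = "vjoin {([], [])} {([], [])}" and ?H = "hjoin {([], [])} {([], [])}"
    have "?V \<in> vcut k" "?H \<in> hcut k" unfolding vcut_def hcut_def 0 by auto
    moreover have "vflip ?V ?H"
      unfolding vflip_def vjoin_def hjoin_def
      by (rule exI[of _ "{}"], rule exI[of _ "[]"], rule exI[of _ "[]"]) (simp add: insert_commute)
    ultimately show ?thesis
      using that[of ?V ?H] unfolding flip_rel_def tilings_Suc by blast
  next
    case (Suc m)
    obtain S where S: "S \<in> tilings m" using tilings_nonempty by blast
    let ?T = "vjoin (hjoin S S) (hjoin S S)"
    have "?T \<in> vcut k"
      using joins_in_tilings[OF S S] unfolding Suc vcut_def by blast
    moreover have "?T \<in> hcut k"
      using joins_in_tilings[OF S S] unfolding Suc hcut_def vjoin_hjoin by blast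
    ultimately show ?thesis using that by blast
  qed
  have "(S, S') \<in> (flip_rel (Suc k))\<^sup>*" "(S', S) \<in> (flip_rel (Suc k))\<^sup>*"
    if "S \<in> vcut k" "S' \<in> hcut k" for S S'
    using rtrancl_trans[OF v[OF that(1) VH(1)] rtrancl_trans[OF VH(3) h[OF VH(2) that(2)]]]
      rtrancl_trans[OF h[OF that(2) VH(2)] rtrancl_trans[OF VH(4) v[OF VH(1) that(1)]]] by simp_all
  then show ?case
    using Suc.prems v h unfolding tilings_Suc by (elim UnE) simp_all
qed simp

section \<open>The bottleneck\<close>

text \<open>A flip out of \<open>vcut k\<close> is determined by the tiling and by the word \<open>q\<close> of the row that appears across
  the line \<open>x = 1/2\<close>, and this row is present in both halves of the tiling before the flip.\<close>

lemma card_boundary_pairs: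
  "golden_ratio ^ (2 * k) *
    real (card {(T, T'). (T, T') \<in> flip_rel (Suc k) \<and> T \<in> vcut k \<and> T' \<notin> vcut k})
    \<le> 2 ^ k * num_tilings k ^ 2"
proof -
  let ?P = "{(T, T'). (T, T') \<in> flip_rel (Suc k) \<and> T \<in> vcut k \<and> T' \<notin> vcut k}"
  let ?Q = "{q :: bool list. length q = k}"
  let ?B = "\<lambda>q. {T \<in> tilings k. ([], q) \<in> T}"
  define flip where "flip = (\<lambda>(q, T\<^sub>0, T\<^sub>1).
    (vjoin T\<^sub>0 T\<^sub>1, vjoin T\<^sub>0 T\<^sub>1 - {([False], q), ([True], q)} \<union> {([], q @ [False]), ([], q @ [True])}))"
  have finQ: "finite ?Q" and cardQ: "card ?Q = 2 ^ k"
    using finite_lists_length_eq[of "UNIV :: bool set" k] card_lists_length_eq[of "UNIV :: bool set" k]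
    by simp_all
  have finB: "finite (?B q)" for q by (simp add: finite_tilings)
  have "?P \<subseteq> flip ` (SIGMA q:?Q. ?B q \<times> ?B q)"
  proof clarify
    fix T T' assume flip: "(T, T') \<in> flip_rel (Suc k)" and T: "T \<in> vcut k" and T': "T' \<notin> vcut k"
    have mem: "T' \<in> tilings (Suc k)" using flip by (simp add: flip_rel_def)
    have full: "\<exists>q. ([], q) \<in> T'"
      using vjoin_if_no_full_width[OF mem] T' unfolding vcut_def by auto
    then obtain r where r: "([], r) \<in> T'" by blast
    have noT: "([], q) \<notin> T" for q using no_full_width_if_vcut[OF T] .
    have nv: "\<not> vflip T' T"
    proof
      assume "vflip T' T"
      then obtain X p q where X: "T' = X \<union> {(p @ [False], q), (p @ [True], q)}"
         "T = X \<union> {(p, q @ [False]), (p, q @ [True])}" by (rule vflipE)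
      then show False using r noT by auto
    qed
    then have "vflip T T'" using flip by (auto simp: flip_rel_def)
    from this obtain X p q where X: "T = X \<union> {(p @ [False], q), (p @ [True], q)}"
        "T' = X \<union> {(p, q @ [False]), (p, q @ [True])}"
        "X \<inter> {(p @ [False], q), (p @ [True], q), (p, q @ [False]), (p, q @ [True])} = {}"
      by (rule vflipE)
    have p: "p = []" using r noT X(1,2) by auto
    obtain T\<^sub>0 T\<^sub>1 where J: "T = vjoin T\<^sub>0 T\<^sub>1" "T\<^sub>0 \<in> tilings k" "T\<^sub>1 \<in> tilings k"
      using T by (auto simp: vcut_def)
    have "([False], q) \<in> T" "([True], q) \<in> T" using X(1) p by auto
    then have q: "([], q) \<in> T\<^sub>0" "([], q) \<in> T\<^sub>1" using J(1) by simp_all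
    then have "length q = k" using length_tiling[OF J(2)] by fastforce
    moreover have "T' = T - {([False], q), ([True], q)} \<union> {([], q @ [False]), ([], q @ [True])}"
      using X p by auto
    ultimately show "(T, T') \<in> flip ` (SIGMA q:?Q. ?B q \<times> ?B q)"
      using J q by (intro image_eqI[of _ _ "(q, T\<^sub>0, T\<^sub>1)"]) (simp_all add: flip_def)
  qed
  then have "card ?P \<le> card (flip ` (SIGMA q:?Q. ?B q \<times> ?B q))"
    using finQ finB by (intro card_mono) auto
  also have "\<dots> \<le> card (SIGMA q:?Q. ?B q \<times> ?B q)"
    using finQ finB by (intro card_image_le) auto
  also have "\<dots> = (\<Sum>q\<in>?Q. card (?B q) ^ 2)"
    using finQ finB by (simp add: power2_eq_square)
  finally have "real (card ?P) \<le> (\<Sum>q\<in>?Q. real (card (?B q)) ^ 2)"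
    by (simp flip: of_nat_power of_nat_sum)
  then have "golden_ratio ^ (2 * k) * real (card ?P) \<le> golden_ratio ^ (2 * k) * (\<Sum>q\<in>?Q. real (card (?B q)) ^ 2)"
    using golden_ratio_gt_1 by (intro mult_left_mono) auto
  also have "\<dots> = (\<Sum>q\<in>?Q. (golden_ratio ^ k * real (card (?B q))) ^ 2)"
    by (simp add: sum_distrib_left power_mult_distrib power_even_eq)
  also have "\<dots> \<le> (\<Sum>q\<in>?Q. num_tilings k ^ 2)"
    using golden_ratio_gt_1 card_tilings_with_row by (intro sum_mono power_mono) auto
  finally show ?thesis using cardQ by simp
qed

section \<open>The geometric meaning of words\<close>

text \<open>The end points of the dyadic interval of a word.\<close>

fun lo :: "bool list \<Rightarrow> real" where
  "lo [] = 0"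
| "lo (b # w) = (of_bool b + lo w) / 2"

definition hi :: "bool list \<Rightarrow> real" where
  "hi w = lo w + 1 / 2 ^ length w"

text \<open>The dyadic interval of a word and the dyadic rectangle of a tile.\<close>

definition ival :: "bool list \<Rightarrow> real set" where
  "ival w = {lo w..hi w}"

definition rect :: "tile \<Rightarrow> (real \<times> real) set" where
  "rect t = ival (fst t) \<times> ival (snd t)"

lemma hi_simps [simp]: "hi [] = 1" "hi (b # w) = (of_bool b + hi w) / 2"
  by (simp_all add: hi_def field_simps)

lemma lo_less_hi: "lo w < hi w"
  by (simp add: hi_def)

lemma lo_hi_bounds: "0 \<le> lo w" "hi w \<le> 1"
  by (induction w) auto

lemma lo_append: "lo (w @ [b]) = lo w + of_bool b / 2 ^ Suc (length w)"
  by (induction w) (auto simp: field_simps)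

lemma hi_append: "hi (w @ [b]) = lo w + (1 + of_bool b) / 2 ^ Suc (length w)"
  by (simp add: hi_def lo_append add_divide_distrib)

lemma lo_inj:
  assumes "length u = length v" "lo u = lo v"
  shows "u = v"
  using assms
proof (induction u v rule: list_induct2)
  case (Cons b u c v)
  have "lo u < 1" "lo v < 1" "0 \<le> lo u" "0 \<le> lo v"
    using lo_less_hi[of u] lo_less_hi[of v] lo_hi_bounds[of u] lo_hi_bounds[of v] by linarith+
  then show ?case using Cons by (cases b; cases c) auto
qed simp

lemma hi_inj:
  assumes "length u = length v" "hi u = hi v"
  shows "u = v"
  using assms lo_inj[of u v] by (simp add: hi_def)

lemma Icc_eq_ival_iff: "{a..b} = ival w \<longleftrightarrow> a = lo w \<and> b = hi w"
  unfolding ival_def using lo_less_hi[of w] by (simp add: Icc_eq_Icc)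

lemma ival_inj [simp]: "ival u = ival v \<longleftrightarrow> u = v"
proof
  assume "ival u = ival v"
  then have eq: "lo u = lo v" "hi u = hi v"
    using Icc_eq_ival_iff[of "lo u" "hi u" v] by (simp_all add: ival_def)
  then have "length u = length v" by (simp add: hi_def)
  then show "u = v" using eq lo_inj by blast
qed simp

lemma ival_nonempty [simp]: "ival w \<noteq> {}"
  using lo_less_hi[of w] by (simp add: ival_def)

lemma rect_inj [simp]: "rect s = rect t \<longleftrightarrow> s = t"
  by (cases s; cases t) (simp add: rect_def times_eq_iff)

lemma inj_rect: "inj_on rect A"
  by (simp add: inj_on_def)

lemma dyadic_interval_iff: "dyadic_interval I \<longleftrightarrow> (\<exists>w. I = ival w)"
proof
  have "\<exists>w. length w = s \<and> lo w = real a / 2 ^ s" if "a < 2 ^ s" for a s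
    using that
  proof (induction s arbitrary: a)
    case (Suc s)
    show ?case
    proof (cases "a < 2 ^ s")
      case True
      then obtain w where "length w = s" "lo w = real a / 2 ^ s" using Suc.IH by blast
      then show ?thesis by (intro exI[of _ "False # w"]) simp
    next
      case False
      then have "a - 2 ^ s < 2 ^ s" using Suc.prems by simp
      then obtain w where "length w = s" "lo w = real (a - 2 ^ s) / 2 ^ s" using Suc.IH by blast
      then show ?thesis using False
        by (intro exI[of _ "True # w"]) (simp add: of_nat_diff field_simps)
    qed
  qed simp
  then show "\<exists>w. I = ival w" if "dyadic_interval I"
    using that unfolding dyadic_interval_def ival_def hi_def
    by (metis add_divide_distrib)
next
  have "\<exists>a<2 ^ length w. lo w = real a / 2 ^ length w" for w
  proof (induction w)
    case (Cons b w)
    then obtain a where a: "a < 2 ^ length w" "lo w = real a / 2 ^ length w" by blast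
    then show ?case
      by (intro exI[of _ "(if b then 2 ^ length w else 0) + a"]) (auto simp: field_simps)
  qed simp
  then show "dyadic_interval I" if "\<exists>w. I = ival w"
    using that unfolding dyadic_interval_def ival_def hi_def
    by (metis add_divide_distrib)
qed

lemma dyadic_rectangle_iff: "dyadic_rectangle R \<longleftrightarrow> (\<exists>t. R = rect t)"
  unfolding dyadic_rectangle_def dyadic_interval_iff rect_def by auto

lemma rect_eq_cbox: "rect t = cbox (lo (fst t), lo (snd t)) (hi (fst t), hi (snd t))"
  by (simp add: rect_def ival_def cbox_Pair_eq)

lemma measure_rect: "measure lborel (rect t) = 1 / 2 ^ (length (fst t) + length (snd t))"
  unfolding rect_eq_cbox using lo_less_hi[of "fst t"] lo_less_hi[of "snd t"]
  by (simp add: content_Pair hi_def power_add)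

lemma interior_rect:
  "interior (rect t) = {lo (fst t)<..<hi (fst t)} \<times> {lo (snd t)<..<hi (snd t)}"
  by (simp add: rect_def ival_def interior_Times)

lemma rect_subset: "rect t \<subseteq> {0..1} \<times> {0..1}"
  using lo_hi_bounds[of "fst t"] lo_hi_bounds[of "snd t"] by (auto simp: rect_def ival_def)

text \<open>The tiles do not overlap and cover the unit square. This is the condition \<open>division_of\<close> with the
  parts removed that hold for every set of tiles.\<close>

definition tiles_square :: "tile set \<Rightarrow> bool" where
  "tiles_square T \<longleftrightarrow> finite T \<and>
     (\<forall>s\<in>T. \<forall>t\<in>T. s \<noteq> t \<longrightarrow> interior (rect s) \<inter> interior (rect t) = {}) \<and>
     {0..1} \<times> {0..1} \<subseteq> \<Union> (rect ` T)"

lemma tiles_squareD: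
  assumes "tiles_square T"
  shows "finite T"
    and "s \<in> T \<Longrightarrow> t \<in> T \<Longrightarrow> s \<noteq> t \<Longrightarrow> interior (rect s) \<inter> interior (rect t) = {}"
    and "z \<in> {0..1} \<times> {0..1} \<Longrightarrow> \<exists>t\<in>T. z \<in> rect t"
proof -
  note T = assms[unfolded tiles_square_def]
  show "finite T" using T by (rule conjunct1)
  show "interior (rect s) \<inter> interior (rect t) = {}" if "s \<in> T" "t \<in> T" "s \<noteq> t"
    using T[THEN conjunct2, THEN conjunct1, rule_format, OF that] .
  show "\<exists>t\<in>T. z \<in> rect t" if "z \<in> {0..1} \<times> {0..1}"
    using T[THEN conjunct2, THEN conjunct2, THEN subsetD, OF that] by (rule UN_E) (rule bexI)
qed

lemma division_of_rects: "rect ` T division_of ({0..1} \<times> {0..1}) \<longleftrightarrow> tiles_square T"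
proof -
  have "finite (rect ` T) \<longleftrightarrow> finite T"
    using inj_rect finite_imageD by blast
  moreover have "\<Union> (rect ` T) = {0..1} \<times> {0..1} \<longleftrightarrow> {0..1} \<times> {0..1} \<subseteq> \<Union> (rect ` T)"
    using rect_subset by blast
  moreover have "rect t \<subseteq> {0..1} \<times> {0..1} \<and> rect t \<noteq> {} \<and> (\<exists>a b. rect t = cbox a b)" for t
    using rect_subset[of t] rect_eq_cbox[of t] by (metis Times_empty ival_nonempty rect_def)
  ultimately show ?thesis
    unfolding division_of_def tiles_square_def by simp
qed

lemma swap_rect: "rect (prod.swap t) = prod.swap ` rect t"
  by (simp add: rect_def product_swap)

lemma tiles_square_swap: "tiles_square (prod.swap ` T) \<longleftrightarrow> tiles_square T"
proof -
  have *: "tiles_square (prod.swap ` T)" if "tiles_square T" for T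
    unfolding tiles_square_def
  proof (intro conjI ballI impI)
    show "finite (prod.swap ` T)" using that by (simp add: tiles_square_def)
  next
    fix s t assume "s \<in> prod.swap ` T" "t \<in> prod.swap ` T" "s \<noteq> t"
    then have "prod.swap s \<in> T" "prod.swap t \<in> T" "prod.swap s \<noteq> prod.swap t" by auto
    then have "interior (rect (prod.swap s)) \<inter> interior (rect (prod.swap t)) = {}"
      by (rule tiles_squareD(2)[OF that])
    then show "interior (rect s) \<inter> interior (rect t) = {}"
      unfolding interior_rect by (auto simp: Times_Int_Times)
  next
    show "{0..1} \<times> {0..1} \<subseteq> \<Union> (rect ` prod.swap ` T)"
    proof clarify
      fix x y :: real assume "x \<in> {0..1}" "y \<in> {0..1}"
      then have "(y, x) \<in> \<Union> (rect ` T)" using tiles_squareD(3)[OF that, of "(y, x)"] by simp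
      then show "(x, y) \<in> \<Union> (rect ` prod.swap ` T)" by (auto simp: rect_def)
    qed
  qed
  show ?thesis using *[of T] *[of "prod.swap ` T"] by (auto simp: image_image)
qed

text \<open>Finite unions of tiles are closed, so the vertical sides of the unit square need no separate check. In
  the next lemma this avoids the points on the line \<open>x = 1/2\<close>, which may be covered from either
  side.\<close>

lemma covers_if_covers_interior:
  assumes "finite T" "{0<..<1} \<times> {0..1} \<subseteq> \<Union> (rect ` T)"
  shows "{0..1} \<times> {0..1} \<subseteq> \<Union> (rect ` T)"
proof -
  have "closed (\<Union> (rect ` T))"
    using assms(1) by (intro closed_UN) (simp_all add: rect_eq_cbox closed_cbox)
  then have "closure ({0<..<1} \<times> {0..1}) \<subseteq> \<Union> (rect ` T)"
    using assms(2) by (rule closure_minimal[rotated])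
  then show ?thesis by (simp add: closure_Times)
qed

lemma tiles_square_vjoin: "tiles_square (vjoin T\<^sub>0 T\<^sub>1) \<longleftrightarrow> tiles_square T\<^sub>0 \<and> tiles_square T\<^sub>1"
proof
  assume tiles: "tiles_square (vjoin T\<^sub>0 T\<^sub>1)"
  have fin: "finite T\<^sub>0" "finite T\<^sub>1"
    using tiles_squareD(1)[OF tiles] by (simp_all add: finite_joins)
  have disj: "interior (rect (b # p, q)) \<inter> interior (rect (b # p', q')) = {}"
    if "(b # p, q) \<in> vjoin T\<^sub>0 T\<^sub>1" "(b # p', q') \<in> vjoin T\<^sub>0 T\<^sub>1" "(p, q) \<noteq> (p', q')" for b p q p' q'
    using tiles_squareD(2)[OF tiles that(1,2)] that(3) by simp
  have disj': "interior (rect (p, q)) \<inter> interior (rect (p', q')) = {}"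
    if "(b # p, q) \<in> vjoin T\<^sub>0 T\<^sub>1" "(b # p', q') \<in> vjoin T\<^sub>0 T\<^sub>1" "(p, q) \<noteq> (p', q')" for b p q p' q'
  proof (rule ccontr)
    assume "\<not> ?thesis"
    then obtain x y where "(x, y) \<in> interior (rect (p, q))" "(x, y) \<in> interior (rect (p', q'))" by auto
    then have "((of_bool b + x) / 2, y) \<in> interior (rect (b # p, q)) \<inter> interior (rect (b # p', q'))"
      by (auto simp: interior_rect)
    then show False using disj[OF that] by blast
  qed
  have cov: "\<exists>p q. (b # p, q) \<in> vjoin T\<^sub>0 T\<^sub>1 \<and> (x, y) \<in> rect (p, q)"
    if "0 < x" "x < 1" "0 \<le> y" "y \<le> 1" for b x y
  proof -
    have "((of_bool b + x) / 2, y) \<in> {0..1} \<times> {0..1}" using that by auto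
    from tiles_squareD(3)[OF tiles this]
    obtain t where t: "t \<in> vjoin T\<^sub>0 T\<^sub>1" "((of_bool b + x) / 2, y) \<in> rect t" by blast
    obtain c p q where pq: "t = (c # p, q)" using t(1) by (auto simp: vjoin_def)
    have "0 \<le> lo p" "hi p \<le> 1" by (rule lo_hi_bounds)+
    then have "c = b" using t(2) that unfolding pq by (cases b; cases c) (auto simp: rect_def ival_def)
    then show ?thesis using t that unfolding pq
      by (intro exI[of _ p] exI[of _ q]) (auto simp: rect_def ival_def)
  qed
  show "tiles_square T\<^sub>0 \<and> tiles_square T\<^sub>1"
  proof
    show "tiles_square T\<^sub>0"
      unfolding tiles_square_def
    proof (intro conjI ballI impI fin)
      show "interior (rect s) \<inter> interior (rect t) = {}" if "s \<in> T\<^sub>0" "t \<in> T\<^sub>0" "s \<noteq> t" for s t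
        using disj'[of False "fst s" "snd s" "fst t" "snd t"] that by simp
      show "{0..1} \<times> {0..1} \<subseteq> \<Union> (rect ` T\<^sub>0)"
        by (rule covers_if_covers_interior[OF fin(1)]) (use cov[of _ _ False] in force)
    qed
    show "tiles_square T\<^sub>1"
      unfolding tiles_square_def
    proof (intro conjI ballI impI fin)
      show "interior (rect s) \<inter> interior (rect t) = {}" if "s \<in> T\<^sub>1" "t \<in> T\<^sub>1" "s \<noteq> t" for s t
        using disj'[of True "fst s" "snd s" "fst t" "snd t"] that by simp
      show "{0..1} \<times> {0..1} \<subseteq> \<Union> (rect ` T\<^sub>1)"
        by (rule covers_if_covers_interior[OF fin(2)]) (use cov[of _ _ True] in force)
    qed
  qed
next
  assume tiles: "tiles_square T\<^sub>0 \<and> tiles_square T\<^sub>1"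
  show "tiles_square (vjoin T\<^sub>0 T\<^sub>1)"
    unfolding tiles_square_def
  proof (intro conjI ballI impI)
    show "finite (vjoin T\<^sub>0 T\<^sub>1)" using tiles tiles_squareD(1) unfolding finite_joins by blast
  next
    fix s t assume st: "s \<in> vjoin T\<^sub>0 T\<^sub>1" "t \<in> vjoin T\<^sub>0 T\<^sub>1" "s \<noteq> t"
    obtain b p q where s: "s = (b # p, q)" using st(1) by (auto simp: vjoin_def)
    obtain c p' q' where t: "t = (c # p', q')" using st(2) by (auto simp: vjoin_def)
    note eq = s t
    show "interior (rect s) \<inter> interior (rect t) = {}"
    proof (rule ccontr)
      assume "\<not> ?thesis"
      then obtain x y where xy: "(x, y) \<in> interior (rect s)" "(x, y) \<in> interior (rect t)" by auto
      have bd: "0 \<le> lo p" "hi p \<le> 1" "0 \<le> lo p'" "hi p' \<le> 1" by (rule lo_hi_bounds)+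
      have "b = c" using xy bd unfolding eq by (cases b; cases c) (auto simp: interior_rect)
      then have "(2 * x - of_bool b, y) \<in> interior (rect (p, q)) \<inter> interior (rect (p', q'))"
        using xy unfolding eq by (auto simp: interior_rect)
      moreover have "interior (rect (p, q)) \<inter> interior (rect (p', q')) = {}"
        using tiles st tiles_squareD(2)[of "if c then T\<^sub>1 else T\<^sub>0" "(p, q)" "(p', q')"]
        unfolding eq \<open>b = c\<close> by (simp split: if_splits)
      ultimately show False by blast
    qed
  next
    show "{0..1} \<times> {0..1} \<subseteq> \<Union> (rect ` vjoin T\<^sub>0 T\<^sub>1)"
    proof clarify
      fix x y :: real assume xy: "x \<in> {0..1}" "y \<in> {0..1}"
      define b where "b \<longleftrightarrow> x > 1 / 2"
      have sq: "(2 * x - of_bool b, y) \<in> {0..1} \<times> {0..1}" using xy by (auto simp: b_def)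
      have "tiles_square (if b then T\<^sub>1 else T\<^sub>0)" using tiles by simp
      from tiles_squareD(3)[OF this sq] obtain p q
        where "(p, q) \<in> (if b then T\<^sub>1 else T\<^sub>0)" "(2 * x - of_bool b, y) \<in> rect (p, q)"
        by (auto simp del: if_split)
      then have "(b # p, q) \<in> vjoin T\<^sub>0 T\<^sub>1" "(x, y) \<in> rect (b # p, q)"
        by (auto simp: rect_def ival_def)
      then show "(x, y) \<in> \<Union> (rect ` vjoin T\<^sub>0 T\<^sub>1)" by blast
    qed
  qed
qed

lemma tiles_square_hjoin: "tiles_square (hjoin T\<^sub>0 T\<^sub>1) \<longleftrightarrow> tiles_square T\<^sub>0 \<and> tiles_square T\<^sub>1"
  using tiles_square_vjoin[of "prod.swap ` T\<^sub>0" "prod.swap ` T\<^sub>1"]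
  by (simp add: tiles_square_swap flip: swap_hjoin)

text \<open>A tile of full width and a tile of full height overlap. Hence a tiling without one of the two
  kinds splits along a midline, and both descriptions of tilings obey the same recursion.\<close>

lemma tilings_iff:
  "T \<in> tilings k \<longleftrightarrow> tiles_square T \<and> (\<forall>(p, q)\<in>T. length p + length q = k)"
proof
  assume T: "T \<in> tilings k"
  have "tiles_square T"
    using T
  proof (induction k arbitrary: T)
    case 0
    have "rect ([], []) = {0..1} \<times> {0..1}" by (simp add: rect_def ival_def)
    then show ?case using 0 by (simp add: tiles_square_def)
  next
    case (Suc k)
    from Suc.prems show ?case
      by (cases rule: tilings_SucE) (simp_all add: tiles_square_vjoin tiles_square_hjoin Suc.IH)
  qed
  then show "tiles_square T \<and> (\<forall>(p, q)\<in>T. length p + length q = k)"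
    using length_tiling[OF T] by blast
next
  assume "tiles_square T \<and> (\<forall>(p, q)\<in>T. length p + length q = k)"
  then show "T \<in> tilings k"
  proof (induction k arbitrary: T)
    case 0
    then have "T \<subseteq> {([], [])}" by auto
    moreover have "(0, 0) \<in> \<Union> (rect ` T)"
      using 0 tiles_squareD(3)[of T "(0, 0)"] by simp
    then have "T \<noteq> {}" by auto
    ultimately show ?case by auto
  next
    case (Suc k)
    have "(\<forall>q. ([], q) \<notin> T) \<or> (\<forall>p. (p, []) \<notin> T)"
    proof (rule ccontr)
      assume "\<not> ?thesis"
      then obtain p q where pq: "([], q) \<in> T" "(p, []) \<in> T" by blast
      have "([], q) \<noteq> (p, [])" using pq Suc.prems by auto
      then have "interior (rect ([], q)) \<inter> interior (rect (p, [])) = {}"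
        using pq Suc.prems tiles_squareD(2) by blast
      moreover have "((lo p + hi p) / 2, (lo q + hi q) / 2) \<in> interior (rect ([], q)) \<inter> interior (rect (p, []))"
        using lo_less_hi[of p] lo_less_hi[of q] lo_hi_bounds[of p] lo_hi_bounds[of q]
        by (simp add: interior_rect)
      ultimately show False by blast
    qed
    then show ?case
    proof
      assume *: "\<forall>q. ([], q) \<notin> T"
      define S where "S b = {(p, q). (b # p, q) \<in> T}" for b
      have T: "T = vjoin (S False) (S True)"
      proof (rule Set.set_eqI, unfold split_paired_all)
        fix p q show "(p, q) \<in> T \<longleftrightarrow> (p, q) \<in> vjoin (S False) (S True)"
          using * by (cases p) (auto simp: S_def)
      qed
      have "S b \<in> tilings k" for b
      proof (rule Suc.IH)
        have "tiles_square (S b)"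
          using Suc.prems T tiles_square_vjoin[of "S False" "S True"] by (cases b) simp_all
        then show "tiles_square (S b) \<and> (\<forall>(p, q)\<in>S b. length p + length q = k)"
          using Suc.prems unfolding S_def by fastforce
      qed
      then show ?thesis using T joins_in_tilings by metis
    next
      assume *: "\<forall>p. (p, []) \<notin> T"
      define S where "S b = {(p, q). (p, b # q) \<in> T}" for b
      have T: "T = hjoin (S False) (S True)"
      proof (rule Set.set_eqI, unfold split_paired_all)
        fix p q show "(p, q) \<in> T \<longleftrightarrow> (p, q) \<in> hjoin (S False) (S True)"
          using * by (cases q) (auto simp: S_def)
      qed
      have "S b \<in> tilings k" for b
      proof (rule Suc.IH)
        have "tiles_square (S b)"
          using Suc.prems T tiles_square_hjoin[of "S False" "S True"] by (cases b) simp_all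
        then show "tiles_square (S b) \<and> (\<forall>(p, q)\<in>S b. length p + length q = k)"
          using Suc.prems unfolding S_def by fastforce
      qed
      then show ?thesis using T joins_in_tilings by metis
    qed
  qed
qed

text \<open>The recursively defined sets of tiles are the dyadic tilings.\<close>

lemma dyadic_tilings_eq: "dyadic_tilings k = (`) rect ` tilings k"
proof (intro equalityI subsetI)
  fix D assume D: "D \<in> dyadic_tilings k"
  then have div: "D division_of ({0..1} \<times> {0..1})"
    and D: "\<And>R. R \<in> D \<Longrightarrow> dyadic_rectangle R" "\<And>R. R \<in> D \<Longrightarrow> measure lborel R = 1 / 2 ^ k"
    by (simp_all add: dyadic_tilings_def)
  define T where "T = rect -` D"
  have "D \<subseteq> range rect"
    using D(1) unfolding dyadic_rectangle_iff by auto
  then have DT: "D = rect ` T"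
    unfolding T_def image_vimage_eq by auto
  have "length p + length q = k" if "(p, q) \<in> T" for p q
  proof -
    have "measure lborel (rect (p, q)) = 1 / 2 ^ k"
      using D(2) that unfolding T_def by simp
    then show ?thesis by (simp add: measure_rect)
  qed
  moreover have "tiles_square T"
    using div unfolding DT division_of_rects .
  ultimately have "T \<in> tilings k" unfolding tilings_iff by auto
  then show "D \<in> (`) rect ` tilings k" using DT by (rule image_eqI[rotated])
next
  fix D assume "D \<in> (`) rect ` tilings k"
  then obtain T where T: "T \<in> tilings k" "D = rect ` T" by blast
  have "card (rect ` T) = 2 ^ k"
    using finite_card_tiling[OF T(1)] by (simp add: card_image inj_rect)
  moreover have "rect ` T division_of ({0..1} \<times> {0..1})"
    using T(1) unfolding tilings_iff division_of_rects by (rule conjunct1)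
  moreover have "measure lborel (rect t) = 1 / 2 ^ k" if "t \<in> T" for t
    using length_tiling[OF T(1), of "fst t" "snd t"] that by (simp add: measure_rect)
  ultimately show "D \<in> dyadic_tilings k"
    unfolding T(2) dyadic_tilings_def dyadic_rectangle_iff by auto
qed

lemma rect_image_eq [simp]: "rect ` S = rect ` T \<longleftrightarrow> S = T"
  by (rule inj_image_eq_iff) (rule inj_rect)

lemma rects_in_dyadic_tilings [simp]: "rect ` T \<in> dyadic_tilings k \<longleftrightarrow> T \<in> tilings k"
  unfolding dyadic_tilings_eq by (simp add: image_iff)

section \<open>Transition probabilities\<close>

text \<open>Reflection in the diagonal exchanges vertical and horizontal flips, so that only the former have to
  be computed.\<close>

fun swap_dir :: "direction \<Rightarrow> direction" where
  "swap_dir Left = Bottom"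
| "swap_dir Right = Top"
| "swap_dir Top = Right"
| "swap_dir Bottom = Left"

abbreviation mirror :: "(real \<times> real) set \<Rightarrow> (real \<times> real) set" where
  "mirror R \<equiv> prod.swap ` R"

lemma swap_dir_swap_dir [simp]: "swap_dir (swap_dir d) = d"
  by (cases d) simp_all

lemma mirror_mirror [simp]: "mirror (mirror R) = R"
  by (simp add: image_image)

lemma mirror_eq_iff [simp]: "mirror R = mirror S \<longleftrightarrow> R = S"
  by (metis mirror_mirror)

lemma mirror_images_eq_iff [simp]: "mirror ` D = mirror ` E \<longleftrightarrow> D = E"
  by (rule inj_image_eq_iff) (simp add: inj_def)

lemma swap_swap_image [simp]: "prod.swap ` prod.swap ` T = T"
  by (simp add: image_image)

lemma side_mirror: "side (swap_dir d) (mirror R) = mirror (side d R)"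
  by (cases d) (auto simp: image_iff)

lemma UNIV_direction: "UNIV = {Left, Right, Top, Bottom}"
  using direction.exhaust by auto

instance direction :: finite
  by standard (simp add: UNIV_direction)

lemma sides_mirror: "sides (mirror R) = mirror ` sides R"
proof -
  have "range swap_dir = UNIV" using swap_dir_swap_dir by (rule surjI)
  then have "sides (mirror R) = (\<lambda>d. side d (mirror R)) ` range swap_dir"
    unfolding sides_def by (rule ssubst) (rule refl)
  then show ?thesis unfolding image_image side_mirror sides_def .
qed

lemma center_mirror: "center (mirror Q) = prod.swap (center Q)"
proof -
  have "(SUP z\<in>prod.swap ` Q. z \<bullet> (1, 0)) = (SUP z\<in>Q. z \<bullet> (0, 1))"
    "(SUP z\<in>prod.swap ` Q. z \<bullet> (0, 1)) = (SUP z\<in>Q. z \<bullet> (1, 0))"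
    "(INF z\<in>prod.swap ` Q. z \<bullet> (1, 0)) = (INF z\<in>Q. z \<bullet> (0, 1))"
    "(INF z\<in>prod.swap ` Q. z \<bullet> (0, 1)) = (INF z\<in>Q. z \<bullet> (1, 0))"
    by (simp_all add: image_image inner_prod_def)
  then show ?thesis
    unfolding center_def interval_upperbound_def interval_lowerbound_def sum_Basis_prod_eq
    by (simp add: midpoint_def)
qed

lemma perpendicular_halves_mirror:
  "perpendicular_halves (swap_dir d) (mirror Q) = mirror ` perpendicular_halves d Q"
proof -
  have 1: "{z \<in> mirror Q. P z} = mirror {z \<in> Q. P (prod.swap z)}" for P by auto
  show ?thesis
    by (cases d) (simp_all add: perpendicular_halves_def center_mirror 1)
qed

lemma mirror_rects: "mirror ` rect ` T = rect ` prod.swap ` T"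
  by (simp add: image_image swap_rect)

lemma mirror_dyadic_tilings: "mirror ` D \<in> dyadic_tilings k \<longleftrightarrow> D \<in> dyadic_tilings k"
proof -
  have "mirror ` D \<in> dyadic_tilings k" if D: "D \<in> dyadic_tilings k" for D
  proof -
    obtain T where "T \<in> tilings k" "D = rect ` T" using D unfolding dyadic_tilings_eq by auto
    then show ?thesis by (simp add: mirror_rects swap_tiling)
  qed
  from this[of D] this[of "mirror ` D"] show ?thesis by (auto simp: image_image)
qed

lemma edge_flip_mirror:
  "edge_flip k (mirror ` D) (mirror R) (swap_dir d) = mirror ` edge_flip k D R d"
proof -
  have inj: "inj mirror" by (simp add: inj_def)
  let ?A = "{S \<in> D. side d R \<in> sides S}"
  have A: "{S \<in> mirror ` D. side (swap_dir d) (mirror R) \<in> sides S} = mirror ` ?A"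
    unfolding side_mirror by (auto simp: sides_mirror)
  have card: "card (mirror ` ?A) = card ?A"
    using inj by (intro card_image) (auto simp: inj_on_def)
  have Un: "\<Union> (mirror ` ?A) = mirror (\<Union> ?A)" by auto
  have D': "mirror ` D - mirror ` ?A \<union> mirror ` perpendicular_halves d (\<Union> ?A)
      = mirror ` (D - ?A \<union> perpendicular_halves d (\<Union> ?A))"
    by (simp add: image_Un image_set_diff[OF inj])
  show ?thesis
    unfolding edge_flip_def Let_def A card Un perpendicular_halves_mirror D' mirror_dyadic_tilings
    by simp
qed

lemma side_rect:
  "side Left (rect (p, q)) = {lo p} \<times> ival q"
  "side Right (rect (p, q)) = {hi p} \<times> ival q"
  "side Bottom (rect (p, q)) = ival p \<times> {lo q}"
  "side Top (rect (p, q)) = ival p \<times> {hi q}"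
proof -
  have le: "lo p \<le> hi p" "lo q \<le> hi q" using lo_less_hi[of p] lo_less_hi[of q] by simp_all
  let ?a = "(lo p, lo q)" and ?b = "(hi p, hi q)"
  have mem: "?a \<in> rect (p, q)" "?b \<in> rect (p, q)" using le by (simp_all add: rect_def ival_def)
  have *: "z \<in> rect (p, q) \<longleftrightarrow> lo p \<le> fst z \<and> fst z \<le> hi p \<and> lo q \<le> snd z \<and> snd z \<le> hi q" for z
    by (cases z) (auto simp: rect_def ival_def)
  have "z \<in> side Left (rect (p, q)) \<longleftrightarrow> fst z = lo p \<and> snd z \<in> ival q" for z
    using bspec[OF _ mem(1), of "\<lambda>w. fst z \<le> fst w"] le by (auto simp: * ival_def)
  moreover have "z \<in> side Right (rect (p, q)) \<longleftrightarrow> fst z = hi p \<and> snd z \<in> ival q" for z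
    using bspec[OF _ mem(2), of "\<lambda>w. fst w \<le> fst z"] le by (auto simp: * ival_def)
  moreover have "z \<in> side Bottom (rect (p, q)) \<longleftrightarrow> fst z \<in> ival p \<and> snd z = lo q" for z
    using bspec[OF _ mem(1), of "\<lambda>w. snd z \<le> snd w"] le by (auto simp: * ival_def)
  moreover have "z \<in> side Top (rect (p, q)) \<longleftrightarrow> fst z \<in> ival p \<and> snd z = hi q" for z
    using bspec[OF _ mem(2), of "\<lambda>w. snd w \<le> snd z"] le by (auto simp: * ival_def)
  ultimately show "side Left (rect (p, q)) = {lo p} \<times> ival q"
    "side Right (rect (p, q)) = {hi p} \<times> ival q"
    "side Bottom (rect (p, q)) = ival p \<times> {lo q}"
    "side Top (rect (p, q)) = ival p \<times> {hi q}"
    by (auto simp del: side.simps)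
qed

declare side.simps [simp del]

lemma singleton_ne_ival: "{x} \<noteq> ival w" "ival w \<noteq> {x}"
  using Icc_eq_ival_iff[of x x w] lo_less_hi[of w] by auto

lemma vertical_in_sides_iff:
  "{x} \<times> ival q \<in> sides (rect (p, r)) \<longleftrightarrow> r = q \<and> (lo p = x \<or> hi p = x)"
  unfolding sides_def UNIV_direction
  by (simp add: side_rect times_eq_iff singleton_ne_ival, auto)

lemma center_box:
  assumes "a \<le> b" "c \<le> (d :: real)"
  shows "center ({a..b} \<times> {c..d}) = ((a + b) / 2, (c + d) / 2)"
proof -
  have "{a..b} \<times> {c..d} = cbox (a, c) (b, d)" by (simp add: cbox_Pair_eq)
  moreover have "cbox (a, c) (b, d) \<noteq> {}" using assms by (simp add: cbox_Pair_eq)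
  ultimately show ?thesis
    unfolding center_def by (simp add: midpoint_def)
qed

lemma perpendicular_halves_vertical:
  assumes "d \<in> {Left, Right}" "a \<le> b"
  shows "perpendicular_halves d ({a..b} \<times> ival q) =
    {{a..b} \<times> ival (q @ [False]), {a..b} \<times> ival (q @ [True])}"
proof -
  define m where "m = (lo q + hi q) / 2"
  have m: "lo q < m" "m < hi q" using lo_less_hi[of q] by (simp_all add: m_def)
  have c: "snd (center ({a..b} \<times> ival q)) = m"
    using assms(2) m by (simp add: ival_def center_box m_def)
  have "hi (q @ [False]) = m" "lo (q @ [True]) = m" "lo (q @ [False]) = lo q" "hi (q @ [True]) = hi q"
    by (simp_all add: m_def lo_append hi_append hi_def field_simps)
  then have "{z \<in> {a..b} \<times> ival q. snd z \<le> m} = {a..b} \<times> ival (q @ [False])"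
    "{z \<in> {a..b} \<times> ival q. m \<le> snd z} = {a..b} \<times> ival (q @ [True])"
    using m by (auto simp: ival_def)
  then show ?thesis
    unfolding perpendicular_halves_def c using assms(1) by auto
qed

text \<open>Choosing a vertical side has an effect exactly if it is the common side of the two halves of a
  dyadic rectangle \<open>(p, q)\<close>. That the rectangle is dyadic follows from the requirement that the result
  be a dyadic tiling.\<close>

lemma edge_flip_vertical:
  assumes T: "T \<in> tilings k" and t: "t \<in> T" and d: "d \<in> {Left, Right}"
    and T': "T' \<in> tilings k" "T' \<noteq> T"
  shows "edge_flip k (rect ` T) (rect t) d = rect ` T' \<longleftrightarrow>
    (\<exists>p q. (t = (p @ [False], q) \<and> d = Right \<or> t = (p @ [True], q) \<and> d = Left) \<and>
      {(p @ [False], q), (p @ [True], q)} \<subseteq> T \<and>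
      T' = T - {(p @ [False], q), (p @ [True], q)} \<union> {(p, q @ [False]), (p, q @ [True])})"
    (is "?flip = rect ` T' \<longleftrightarrow> ?R")
proof -
  obtain p0 q where pq: "t = (p0, q)" by (cases t)
  define x where "x = (if d = Left then lo p0 else hi p0)"
  have side: "side d (rect t) = {x} \<times> ival q"
    using d by (auto simp: pq x_def side_rect)
  define B where "B = {p. (p, q) \<in> T \<and> (lo p = x \<or> hi p = x)}"
  define A where "A = {S \<in> rect ` T. side d (rect t) \<in> sides S}"
  have A: "A = rect ` ((\<lambda>p. (p, q)) ` B)"
    unfolding A_def side B_def by (auto simp: vertical_in_sides_iff image_iff)
  have cardA: "card A = card B"
    unfolding A by (simp add: card_image inj_on_def inj_rect)
  have flip_eq: "?flip = (if card A = 2 \<and> rect ` T - A \<union> perpendicular_halves d (\<Union> A) \<in> dyadic_tilings k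
      then rect ` T - A \<union> perpendicular_halves d (\<Union> A) else rect ` T)"
    by (simp add: edge_flip_def A_def Let_def)
  have len: "length p = length p0" if "(p, q) \<in> T" for p
    using length_tiling[OF T that] length_tiling[OF T t[unfolded pq]] by simp
  show ?thesis
  proof
    assume eq: "?flip = rect ` T'"
    then have "?flip \<noteq> rect ` T" using T'(2) by simp
    then have card: "card A = 2" and flip: "?flip = rect ` T - A \<union> perpendicular_halves d (\<Union> A)"
      unfolding flip_eq by (auto split: if_splits)
    have "card B = 2" using card cardA by simp
    then obtain u v where uv: "B = {u, v}" "u \<noteq> v" by (auto simp: card_2_iff)
    have "\<exists>p\<^sub>0 p\<^sub>1. B = {p\<^sub>0, p\<^sub>1} \<and> hi p\<^sub>0 = x \<and> lo p\<^sub>1 = x"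
    proof -
      have mem: "(u, q) \<in> T" "(v, q) \<in> T" "lo u = x \<or> hi u = x" "lo v = x \<or> hi v = x"
        using uv(1) unfolding B_def by blast+
      have "length u = length v" using len mem by simp
      then have "\<not> (lo u = x \<and> lo v = x)" "\<not> (hi u = x \<and> hi v = x)"
        using lo_inj[of u v] hi_inj[of u v] uv(2) by auto
      then have "hi u = x \<and> lo v = x \<or> hi v = x \<and> lo u = x" using mem by blast
      then show ?thesis
      proof
        assume "hi u = x \<and> lo v = x"
        then show ?thesis using uv(1) by (intro exI[of _ u] exI[of _ v]) simp
      next
        assume "hi v = x \<and> lo u = x"
        then show ?thesis using uv(1) insert_commute[of u v "{}"] by (intro exI[of _ v] exI[of _ u]) simp
      qed
    qed
    then obtain p\<^sub>0 p\<^sub>1 where B: "B = {p\<^sub>0, p\<^sub>1}" and x: "hi p\<^sub>0 = x" "lo p\<^sub>1 = x" by blast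
    have mem: "(p\<^sub>0, q) \<in> T" "(p\<^sub>1, q) \<in> T" using B unfolding B_def by blast+
    have le: "lo p\<^sub>0 \<le> hi p\<^sub>1" using lo_less_hi[of p\<^sub>0] lo_less_hi[of p\<^sub>1] x by linarith
    have "ival p\<^sub>0 \<union> ival p\<^sub>1 = {lo p\<^sub>0..hi p\<^sub>1}"
      using x lo_less_hi[of p\<^sub>0] lo_less_hi[of p\<^sub>1] unfolding ival_def by auto
    then have Un: "\<Union> A = {lo p\<^sub>0..hi p\<^sub>1} \<times> ival q"
      unfolding A B by (auto simp: rect_def)
    have halves: "perpendicular_halves d (\<Union> A) =
        {{lo p\<^sub>0..hi p\<^sub>1} \<times> ival (q @ [False]), {lo p\<^sub>0..hi p\<^sub>1} \<times> ival (q @ [True])}"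
      unfolding Un by (rule perpendicular_halves_vertical[OF d le])
    have "{lo p\<^sub>0..hi p\<^sub>1} \<times> ival (q @ [False]) \<in> ?flip" unfolding flip halves by simp
    then obtain w r where "{lo p\<^sub>0..hi p\<^sub>1} \<times> ival (q @ [False]) = rect (w, r)"
      unfolding eq by auto
    then have "{lo p\<^sub>0..hi p\<^sub>1} = ival w" by (simp add: rect_def times_eq_iff)
    then have w: "lo p\<^sub>0 = lo w" "hi p\<^sub>1 = hi w" by (simp_all add: Icc_eq_ival_iff)
    \<comment> \<open>The two tiles are as wide as each other, and so the merged interval has a word that is shorter by
      one letter.\<close>
    have len01: "length p\<^sub>1 = length p\<^sub>0" using len mem by simp
    have "1 / 2 ^ length w = 2 / (2::real) ^ length p\<^sub>0"
      using x w len01 by (simp add: hi_def)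
    then have "(2::real) ^ length p\<^sub>0 = 2 ^ Suc (length w)" by (simp add: field_simps)
    then have lenw: "length p\<^sub>0 = Suc (length w)" by (subst (asm) power_inject_exp) simp_all
    have p\<^sub>0: "p\<^sub>0 = w @ [False]" by (rule lo_inj) (simp_all add: lenw lo_append w)
    have "hi p\<^sub>0 = lo (w @ [True])" by (simp add: hi_def lenw w lo_append)
    then have p\<^sub>1: "p\<^sub>1 = w @ [True]" using x len01 lenw by (intro lo_inj) simp_all
    have "rect ` T' = rect ` T - rect ` {(p\<^sub>0, q), (p\<^sub>1, q)} \<union> rect ` {(w, q @ [False]), (w, q @ [True])}"
    proof -
      have "rect ` {(w, q @ [False]), (w, q @ [True])} = perpendicular_halves d (\<Union> A)"
        unfolding halves by (simp add: rect_def ival_def[of w] w)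
      moreover have "rect ` {(p\<^sub>0, q), (p\<^sub>1, q)} = A" unfolding A B by simp
      ultimately show ?thesis using eq unfolding flip by simp
    qed
    also have "\<dots> = rect ` (T - {(p\<^sub>0, q), (p\<^sub>1, q)} \<union> {(w, q @ [False]), (w, q @ [True])})"
      by (simp only: image_Un image_set_diff[OF inj_rect])
    finally have T'eq: "T' = T - {(p\<^sub>0, q), (p\<^sub>1, q)} \<union> {(w, q @ [False]), (w, q @ [True])}"
      by (simp only: rect_image_eq)
    have "p0 \<in> B" using t unfolding B_def pq x_def by simp
    then have "p0 = p\<^sub>0 \<and> d = Right \<or> p0 = p\<^sub>1 \<and> d = Left"
      using d x lo_less_hi[of p\<^sub>0] lo_less_hi[of p\<^sub>1] unfolding B x_def by (auto split: if_splits)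
    then have "t = (w @ [False], q) \<and> d = Right \<or> t = (w @ [True], q) \<and> d = Left"
      unfolding p\<^sub>0 p\<^sub>1 pq by auto
    moreover have "{(w @ [False], q), (w @ [True], q)} \<subseteq> T" using mem unfolding p\<^sub>0 p\<^sub>1 by simp
    ultimately show ?R using T'eq unfolding p\<^sub>0 p\<^sub>1 by (intro exI[of _ w] exI[of _ q] conjI)
  next
    assume ?R
    then obtain p where
      td: "p0 = p @ [False] \<and> d = Right \<or> p0 = p @ [True] \<and> d = Left" and
      mem: "(p @ [False], q) \<in> T" "(p @ [True], q) \<in> T" and
      T'eq: "T' = T - {(p @ [False], q), (p @ [True], q)} \<union> {(p, q @ [False]), (p, q @ [True])}"
      unfolding pq by auto
    have mid: "hi (p @ [False]) = lo (p @ [True])" by (simp add: hi_append lo_append)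
    have ends: "lo (p @ [False]) = lo p" "hi (p @ [True]) = hi p"
      by (simp_all add: lo_append hi_append hi_def field_simps)
    have x: "x = lo (p @ [True])" using td mid unfolding x_def by auto
    have "length p0 = Suc (length p)" using td by auto
    then have "p' \<in> B \<longleftrightarrow> p' = p @ [False] \<or> p' = p @ [True]" for p'
      using len[of p'] mem lo_inj[of p' "p @ [True]"] hi_inj[of p' "p @ [False]"] mid
      unfolding B_def x by auto
    then have B: "B = {p @ [False], p @ [True]}" by blast
    have "ival (p @ [False]) \<union> ival (p @ [True]) = ival p"
      using mid ends lo_less_hi[of "p @ [False]"] lo_less_hi[of "p @ [True]"] unfolding ival_def by auto
    then have Un: "\<Union> A = {lo p..hi p} \<times> ival q"
      unfolding A B by (auto simp: rect_def ival_def)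
    have A': "A = rect ` {(p @ [False], q), (p @ [True], q)}" unfolding A B by simp
    have halves: "perpendicular_halves d (\<Union> A) = rect ` {(p, q @ [False]), (p, q @ [True])}"
      unfolding Un perpendicular_halves_vertical[OF d less_imp_le[OF lo_less_hi]] by (simp add: rect_def ival_def)
    have "rect ` T - A \<union> perpendicular_halves d (\<Union> A) = rect ` T'"
      by (simp only: halves T'eq image_Un image_set_diff[OF inj_rect] A'[symmetric])
    moreover have "card A = 2" unfolding cardA B by simp
    ultimately show "?flip = rect ` T'"
      unfolding flip_eq using T'(1) by simp
  qed
qed

text \<open>The new tiles cannot be present already because both tilings have the same cardinality.\<close>

lemma vflipI:
  assumes "T \<in> tilings k" "T' \<in> tilings k" "{(p @ [False], q), (p @ [True], q)} \<subseteq> T"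
    and "T' = T - {(p @ [False], q), (p @ [True], q)} \<union> {(p, q @ [False]), (p, q @ [True])}"
  shows "vflip T T'"
proof -
  define X where "X = T - {(p @ [False], q), (p @ [True], q)}"
  let ?N = "{(p, q @ [False]), (p, q @ [True])}"
  have fin: "finite T" "card T = 2 ^ k" "card T' = 2 ^ k"
    using finite_card_tiling assms(1,2) by blast+
  have T': "T' = X \<union> ?N" using assms(4) by (simp only: X_def)
  have "card X + 2 = 2 ^ k"
    using fin assms(3) card_mono[OF fin(1) assms(3)] by (simp add: X_def card_Diff_subset)
  moreover have "card X + card ?N = card T' + card (X \<inter> ?N)"
    unfolding T' using fin(1) by (intro card_Un_Int) (simp_all add: X_def)
  ultimately have "card (X \<inter> ?N) = 0" using fin by simp
  then have "X \<inter> ?N = {}" using fin(1) by (subst (asm) card_0_eq) (simp_all add: X_def)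
  then have "X \<inter> {(p @ [False], q), (p @ [True], q), (p, q @ [False]), (p, q @ [True])} = {}"
    by (auto simp: X_def)
  moreover have "T = X \<union> {(p @ [False], q), (p @ [True], q)}" using assms(3) by (auto simp: X_def)
  ultimately show ?thesis
    unfolding vflip_def using T' by (intro exI[of _ X] exI[of _ p] exI[of _ q] conjI)
qed

text \<open>The rectangle \<open>(p, q)\<close> of a flip can be read off from the tiles that disappear. The edge is
  chosen either as the right side of its left half or as the left side of its right half.\<close>

lemma card_vertical_moves:
  assumes T: "T \<in> tilings k" and T': "T' \<in> tilings k" "T' \<noteq> T"
  shows "card {(t, d). t \<in> T \<and> d \<in> {Left, Right} \<and> edge_flip k (rect ` T) (rect t) d = rect ` T'}
    = (if vflip T T' then 2 else 0)" (is "card ?M = _")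
proof (cases "vflip T T'")
  case True
  then obtain X p q where X: "T = X \<union> {(p @ [False], q), (p @ [True], q)}"
    "T' = X \<union> {(p, q @ [False]), (p, q @ [True])}"
    "X \<inter> {(p @ [False], q), (p @ [True], q), (p, q @ [False]), (p, q @ [True])} = {}"
    by (rule vflipE)
  have diff: "T - T' = {(p @ [False], q), (p @ [True], q)}"
    unfolding X(1,2) using X(3) by auto
  have T'eq: "T' = T - {(p @ [False], q), (p @ [True], q)} \<union> {(p, q @ [False]), (p, q @ [True])}"
    unfolding X(1,2) using X(3) by auto
  have "?M = {((p @ [False], q), Right), ((p @ [True], q), Left)}"
  proof (intro subset_antisym subsetI)
    fix m assume m: "m \<in> ?M"
    then obtain t d where td: "m = (t, d)" "t \<in> T" "d \<in> {Left, Right}"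
      "edge_flip k (rect ` T) (rect t) d = rect ` T'" by blast
    then obtain p' q' where p': "t = (p' @ [False], q') \<and> d = Right \<or> t = (p' @ [True], q') \<and> d = Left"
      "{(p' @ [False], q'), (p' @ [True], q')} \<subseteq> T"
      "T' = T - {(p' @ [False], q'), (p' @ [True], q')} \<union> {(p', q' @ [False]), (p', q' @ [True])}"
      unfolding edge_flip_vertical[OF T td(2,3) T'] by (elim exE conjE) (rule that)
    have "t \<in> T - T'" using p' by auto
    then have "t = (p @ [False], q) \<or> t = (p @ [True], q)" unfolding diff by simp
    then show "m \<in> {((p @ [False], q), Right), ((p @ [True], q), Left)}"
      using p'(1) td(1) by auto
  next
    fix m assume "m \<in> {((p @ [False], q), Right), ((p @ [True], q), Left)}"
    then obtain t d where td: "m = (t, d)"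
      "t = (p @ [False], q) \<and> d = Right \<or> t = (p @ [True], q) \<and> d = Left" by auto
    have t: "t \<in> T" and d: "d \<in> {Left, Right}" using td(2) X(1) by auto
    have "edge_flip k (rect ` T) (rect t) d = rect ` T'"
      unfolding edge_flip_vertical[OF T t d T']
      using td(2) T'eq X(1) by (intro exI[of _ p] exI[of _ q]) simp
    then show "m \<in> ?M" using t d td(1) by simp
  qed
  then show ?thesis using True by simp
next
  case False
  have "?M = {}"
  proof (rule ccontr)
    assume "?M \<noteq> {}"
    then obtain t d where td: "t \<in> T" "d \<in> {Left, Right}"
      "edge_flip k (rect ` T) (rect t) d = rect ` T'" by blast
    then obtain p q where "{(p @ [False], q), (p @ [True], q)} \<subseteq> T"
      "T' = T - {(p @ [False], q), (p @ [True], q)} \<union> {(p, q @ [False]), (p, q @ [True])}"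
      unfolding edge_flip_vertical[OF T td(1,2) T'] by (elim exE conjE) (rule that)
    from vflipI[OF T T'(1) this] show False using False by contradiction
  qed
  then have "card ?M = 0" by (simp only: card.empty)
  then show ?thesis by (simp only: False if_False)
qed

lemma vflip_swap: "vflip (prod.swap ` T) (prod.swap ` T') \<longleftrightarrow> vflip T' T"
proof -
  have "vflip (prod.swap ` T) (prod.swap ` T')" if "vflip T' T" for T T'
  proof -
    obtain X p q where X: "T' = X \<union> {(p @ [False], q), (p @ [True], q)}"
      "T = X \<union> {(p, q @ [False]), (p, q @ [True])}"
      "X \<inter> {(p @ [False], q), (p @ [True], q), (p, q @ [False]), (p, q @ [True])} = {}"
      using \<open>vflip T' T\<close> by (rule vflipE)
    show ?thesis
      unfolding vflip_def
    proof (intro exI conjI)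
      show "prod.swap ` T = prod.swap ` X \<union> {(q @ [False], p), (q @ [True], p)}"
        "prod.swap ` T' = prod.swap ` X \<union> {(q, p @ [False]), (q, p @ [True])}"
        unfolding X(1,2) by (simp_all add: image_Un)
      show "prod.swap ` X \<inter> {(q @ [False], p), (q @ [True], p), (q, p @ [False]), (q, p @ [True])} = {}"
        using X(3) by auto
    qed
  qed
  from this[where T = T and T' = T'] this[where T = "prod.swap ` T'" and T' = "prod.swap ` T"]
  show ?thesis by auto
qed

lemma card_horizontal_moves:
  assumes T: "T \<in> tilings k" and T': "T' \<in> tilings k" "T' \<noteq> T"
  shows "card {(t, d). t \<in> T \<and> d \<in> {Top, Bottom} \<and> edge_flip k (rect ` T) (rect t) d = rect ` T'}
    = (if vflip T' T then 2 else 0)" (is "card ?M = _")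
proof -
  let ?S = "prod.swap ` T" and ?S' = "prod.swap ` T'"
  let ?N = "{(t, d). t \<in> ?S \<and> d \<in> {Left, Right} \<and> edge_flip k (rect ` ?S) (rect t) d = rect ` ?S'}"
  have ne: "?S' \<noteq> ?S" using T'(2) by (metis swap_swap_image)
  have flip: "edge_flip k (rect ` ?S) (rect (prod.swap t)) (swap_dir d) = rect ` ?S' \<longleftrightarrow>
      edge_flip k (rect ` T) (rect t) d = rect ` T'" for t d
    unfolding mirror_rects[symmetric] swap_rect edge_flip_mirror mirror_images_eq_iff ..
  have "bij_betw (\<lambda>(t, d). (prod.swap t, swap_dir d)) ?M ?N"
  proof (rule bij_betw_byWitness[where f' = "\<lambda>(t, d). (prod.swap t, swap_dir d)"])
    show "(\<lambda>(t, d). (prod.swap t, swap_dir d)) ` ?M \<subseteq> ?N"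
    proof (rule image_subsetI)
      fix m assume "m \<in> ?M"
      then obtain t d where "m = (t, d)" "t \<in> T" "d \<in> {Top, Bottom}"
        "edge_flip k (rect ` T) (rect t) d = rect ` T'" by blast
      then show "(case m of (t, d) \<Rightarrow> (prod.swap t, swap_dir d)) \<in> ?N"
        using flip[of t d] by auto
    qed
    show "(\<lambda>(t, d). (prod.swap t, swap_dir d)) ` ?N \<subseteq> ?M"
    proof (rule image_subsetI)
      fix m assume "m \<in> ?N"
      then obtain t d where m: "m = (t, d)" "t \<in> ?S" "d \<in> {Left, Right}"
        "edge_flip k (rect ` ?S) (rect t) d = rect ` ?S'" by blast
      then have "edge_flip k (rect ` T) (rect (prod.swap t)) (swap_dir d) = rect ` T'"
        using flip[of "prod.swap t" "swap_dir d"] by simp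
      then show "(case m of (t, d) \<Rightarrow> (prod.swap t, swap_dir d)) \<in> ?M"
        using m(1-3) by auto
    qed
  qed auto
  then have "card ?M = card ?N" by (rule bij_betw_same_card)
  then show ?thesis
    using card_vertical_moves[OF swap_tiling[OF T] swap_tiling[OF T'(1)] ne] by (simp add: vflip_swap)
qed

text \<open>Of the \<open>4 * 2 ^ k\<close> equally likely choices of a tile and a direction, two produce a given flip.
  The two summands are not both \<open>1\<close>, but only the symmetry of the formula is needed.\<close>

lemma pmf_edge_flip_chain:
  assumes T: "T \<in> tilings k" and T': "T' \<in> tilings k" "T' \<noteq> T"
  shows "pmf (edge_flip_chain k (rect ` T)) (rect ` T') =
    (of_bool (vflip T T') + of_bool (vflip T' T)) / (2 * 2 ^ k)"
proof -
  have fin: "finite T" "card T = 2 ^ k" using finite_card_tiling[OF T] by blast+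
  then have ne: "T \<noteq> {}" by auto
  let ?f = "\<lambda>t d. edge_flip k (rect ` T) (rect t) d = rect ` T'"
  let ?D = "{Left, Right, Top, Bottom}"
  have "pmf (edge_flip_chain k (rect ` T)) (rect ` T') =
      (\<Sum>R\<in>rect ` T. (\<Sum>d\<in>?D. of_bool (edge_flip k (rect ` T) R d = rect ` T')) / 4) / 2 ^ k"
    unfolding edge_flip_chain_def
    using fin ne
    by (simp add: pmf_bind integral_pmf_of_set card_image inj_rect pmf_return indicator_def of_bool_def
        eq_commute[of "rect ` T'"] flip: sum_divide_distrib)
  also have "\<dots> = (\<Sum>t\<in>T. \<Sum>d\<in>?D. of_bool (?f t d)) / (4 * 2 ^ k)"
    by (simp add: sum.reindex inj_rect sum_divide_distrib del: sum.insert)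
  also have "(\<Sum>t\<in>T. \<Sum>d\<in>?D. of_bool (?f t d)) = (\<Sum>(t, d)\<in>T \<times> ?D. of_bool (?f t d) :: real)"
    by (rule sum.cartesian_product)
  also have "\<dots> = real (card {(t, d). t \<in> T \<and> d \<in> ?D \<and> ?f t d})"
  proof -
    have "{(t, d). t \<in> T \<and> d \<in> ?D \<and> ?f t d} = {m \<in> T \<times> ?D. case m of (t, d) \<Rightarrow> ?f t d}" by auto
    moreover have "(\<Sum>m\<in>T \<times> ?D. of_bool (case m of (t, d) \<Rightarrow> ?f t d) :: real) =
        real (card {m \<in> T \<times> ?D. case m of (t, d) \<Rightarrow> ?f t d})"
      using fin(1) by (subst sum_of_bool_eq) (simp_all add: Int_def)
    ultimately show ?thesis by (simp only: case_prod_unfold)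
  qed
  also have "{(t, d). t \<in> T \<and> d \<in> ?D \<and> ?f t d} =
      {(t, d). t \<in> T \<and> d \<in> {Left, Right} \<and> ?f t d} \<union> {(t, d). t \<in> T \<and> d \<in> {Top, Bottom} \<and> ?f t d}"
    by auto
  also have "card \<dots> = (if vflip T T' then 2 else 0) + (if vflip T' T then 2 else 0)"
  proof (subst card_Un_disjoint)
    show "finite {(t, d). t \<in> T \<and> d \<in> {Left, Right} \<and> ?f t d}"
      "finite {(t, d). t \<in> T \<and> d \<in> {Top, Bottom} \<and> ?f t d}"
      using fin(1) by (auto intro: finite_subset[of _ "T \<times> UNIV"])
  qed (use card_vertical_moves[OF assms] card_horizontal_moves[OF assms] in auto)
  finally show ?thesis by (auto simp: field_simps)
qed

lemma set_pmf_edge_flip_chain: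
  assumes "D \<in> dyadic_tilings k"
  shows "set_pmf (edge_flip_chain k D) \<subseteq> dyadic_tilings k"
proof -
  have "edge_flip k D R d \<in> dyadic_tilings k" for R d
    using assms by (simp add: edge_flip_def Let_def)
  then show ?thesis by (auto simp: edge_flip_chain_def)
qed

section \<open>Spectral gap of a symmetric walk\<close>

text \<open>The second entry of the decreasing list of a multiset whose largest element \<open>1\<close> is simple.\<close>

lemma second_largest:
  fixes R :: "real multiset"
  assumes "count R 1 = 1" "\<And>x. x \<in># R \<Longrightarrow> x \<le> 1" "l \<in># R" "l < 1"
  shows "l \<le> rev (sorted_list_of_multiset R) ! 1" "rev (sorted_list_of_multiset R) ! 1 < 1"
proof -
  define R' where "R' = R - {#1#}"
  have "1 \<in># R" using assms(1) by (simp flip: count_greater_zero_iff)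
  then have R: "R = add_mset 1 R'" by (simp add: R'_def)
  have less: "x < 1" if "x \<in># R'" for x
  proof -
    have "1 \<notin># R'" using assms(1) unfolding R by (simp add: not_in_iff)
    then have "x \<noteq> 1" using that by blast
    moreover have "x \<le> 1" using assms(2) that unfolding R by simp
    ultimately show ?thesis by simp
  qed
  define L where "L = rev (sorted_list_of_multiset R')"
  have setL: "set L = set_mset R'" by (simp add: L_def)
  have "sorted (rev L)" by (simp add: L_def)
  have "sorted (rev L @ [1])" using less by (auto simp: sorted_append L_def less_imp_le)
  then have "rev L @ [1] = sort (rev L @ [1])" by (simp add: sorted_sort_id)
  also have "\<dots> = sorted_list_of_multiset (mset (rev L @ [1]))"
    by (simp only: sorted_list_of_multiset_mset)
  also have "mset (rev L @ [1]) = R" by (simp add: L_def R)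
  finally have eq: "rev (sorted_list_of_multiset R) = 1 # L" by (metis rev.simps(2) rev_rev_ident)
  have lL: "l \<in> set L" using assms(3,4) unfolding setL R by auto
  then obtain x L' where L: "L = x # L'" by (cases L) auto
  have "l \<le> x" using lL \<open>sorted (rev L)\<close> unfolding L by (auto simp: sorted_append)
  then show "l \<le> rev (sorted_list_of_multiset R) ! 1" unfolding eq L by simp
  have "x \<in> set L" unfolding L by simp
  then show "rev (sorted_list_of_multiset R) ! 1 < 1" using less unfolding setL eq by (simp add: L)
qed

text \<open>A connected reversible walk on \<open>{..<N}\<close> with uniform stationary distribution.\<close>

locale symmetric_walk =
  fixes N :: nat and P :: "nat \<Rightarrow> nat \<Rightarrow> real"
  assumes P_sym: "i < N \<Longrightarrow> j < N \<Longrightarrow> P i j = P j i"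
    and P_nonneg: "i < N \<Longrightarrow> j < N \<Longrightarrow> 0 \<le> P i j"
    and P_row_sum: "i < N \<Longrightarrow> (\<Sum>j<N. P i j) = 1"
    and P_connected: "i < N \<Longrightarrow> j < N \<Longrightarrow> (i, j) \<in> {(i, j). i < N \<and> j < N \<and> 0 < P i j}\<^sup>*"
begin

text \<open>The transition operator, the inner product of counting measure and the associated Dirichlet form. Only the values of the
  functions on \<open>{..<N}\<close> matter.\<close>

definition avg :: "(nat \<Rightarrow> real) \<Rightarrow> nat \<Rightarrow> real" where
  "avg f i = (\<Sum>j<N. P i j * f j)"

definition ip :: "(nat \<Rightarrow> real) \<Rightarrow> (nat \<Rightarrow> real) \<Rightarrow> real" where
  "ip f g = (\<Sum>i<N. f i * g i)"

definition dirichlet :: "(nat \<Rightarrow> real) \<Rightarrow> real" where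
  "dirichlet f = (\<Sum>i<N. \<Sum>j<N. P i j * (f i - f j) ^ 2) / 2"

lemma col_sum: "j < N \<Longrightarrow> (\<Sum>i<N. P i j) = 1"
  using P_row_sum[of j] P_sym by (metis (mono_tags, lifting) lessThan_iff sum.cong)

lemma sum_avg: "(\<Sum>i<N. avg f i) = (\<Sum>i<N. f i)"
proof -
  have "(\<Sum>i<N. avg f i) = (\<Sum>j<N. \<Sum>i<N. P i j * f j)"
    unfolding avg_def by (rule sum.swap)
  also have "\<dots> = (\<Sum>j<N. f j)"
    by (intro sum.cong) (simp_all add: col_sum flip: sum_distrib_right)
  finally show ?thesis .
qed

lemma ip_commute: "ip f g = ip g f"
  by (simp add: ip_def mult.commute)

lemma ip_avg: "ip f (avg g) = ip (avg f) g"
proof -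
  have "ip f (avg g) = (\<Sum>i<N. \<Sum>j<N. P i j * f i * g j)"
    unfolding ip_def avg_def by (simp add: sum_distrib_left mult_ac)
  also have "\<dots> = (\<Sum>j<N. \<Sum>i<N. P i j * f i * g j)" by (rule sum.swap)
  also have "\<dots> = (\<Sum>j<N. \<Sum>i<N. P j i * f i * g j)" using P_sym by simp
  also have "\<dots> = ip (avg f) g"
    unfolding ip_def avg_def by (simp add: sum_distrib_right)
  finally show ?thesis .
qed

lemma ip_nonneg: "0 \<le> ip f f"
  unfolding ip_def by (intro sum_nonneg) simp

lemma ip_eq_0_iff: "ip f f = 0 \<longleftrightarrow> (\<forall>i<N. f i = 0)"
  unfolding ip_def by (subst sum_nonneg_eq_0_iff) auto

lemma dirichlet_eq: "dirichlet f = ip f f - ip f (avg f)"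
proof -
  have "(\<Sum>i<N. \<Sum>j<N. P i j * (f i - f j) ^ 2) =
      (\<Sum>i<N. \<Sum>j<N. P i j * (f i)^2) + (\<Sum>i<N. \<Sum>j<N. P i j * (f j)^2) - 2 * (\<Sum>i<N. \<Sum>j<N. f i * (P i j * f j))"
    by (simp add: power2_diff algebra_simps sum.distrib sum_subtractf sum_distrib_left)
  also have "(\<Sum>i<N. \<Sum>j<N. P i j * (f j)^2) = (\<Sum>j<N. \<Sum>i<N. P i j * (f j)^2)" by (rule sum.swap)
  also have "\<dots> = ip f f"
    unfolding ip_def by (intro sum.cong) (simp_all add: col_sum power2_eq_square flip: sum_distrib_right)
  also have "(\<Sum>i<N. \<Sum>j<N. P i j * (f i)^2) = ip f f"
    unfolding ip_def by (intro sum.cong) (simp_all add: P_row_sum power2_eq_square flip: sum_distrib_right)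
  also have "(\<Sum>i<N. \<Sum>j<N. f i * (P i j * f j)) = ip f (avg f)"
    unfolding ip_def avg_def by (simp add: sum_distrib_left)
  finally show ?thesis unfolding dirichlet_def by simp
qed

lemma dirichlet_nonneg: "0 \<le> dirichlet f"
  unfolding dirichlet_def by (intro divide_nonneg_nonneg sum_nonneg mult_nonneg_nonneg P_nonneg) auto

text \<open>A harmonic function has Dirichlet form \<open>0\<close>, so it takes equal values at neighbouring points.\<close>

lemma harmonic_constant:
  assumes "\<And>i. i < N \<Longrightarrow> avg f i = f i" "i < N" "j < N"
  shows "f i = f j"
proof -
  have "ip f (avg f) = ip f f" unfolding ip_def using assms(1) by simp
  then have "(\<Sum>i<N. \<Sum>j<N. P i j * (f i - f j) ^ 2) = 0"
    using dirichlet_eq[of f] by (simp add: dirichlet_def)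
  moreover have nn: "0 \<le> P i j * (f i - f j) ^ 2" if "i < N" "j < N" for i j
    using P_nonneg that by simp
  moreover have "(\<Sum>i<N. \<Sum>j<N. P i j * (f i - f j) ^ 2) = 0 \<longleftrightarrow>
      (\<forall>i\<in>{..<N}. (\<Sum>j<N. P i j * (f i - f j) ^ 2) = 0)"
    by (rule sum_nonneg_eq_0_iff) (auto intro!: sum_nonneg nn)
  ultimately have row: "(\<Sum>j<N. P i j * (f i - f j) ^ 2) = 0" if "i < N" for i
    using that by blast
  have 0: "P i j * (f i - f j) ^ 2 = 0" if "i < N" "j < N" for i j
  proof -
    have "(\<Sum>j<N. P i j * (f i - f j) ^ 2) = 0 \<longleftrightarrow> (\<forall>j\<in>{..<N}. P i j * (f i - f j) ^ 2 = 0)"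
      by (rule sum_nonneg_eq_0_iff) (auto intro!: nn that)
    then show ?thesis using row[OF that(1)] that(2) by blast
  qed
  from P_connected[OF assms(2,3)] show ?thesis
    by induction (use 0 in fastforce)+
qed

lemma eigenvalue_le_1:
  assumes "\<And>i. i < N \<Longrightarrow> avg f i = l * f i" "i < N" "f i \<noteq> 0"
  shows "l \<le> 1"
proof -
  have "ip f (avg f) = l * ip f f"
    unfolding ip_def using assms(1) by (simp add: sum_distrib_left mult_ac)
  then have "0 \<le> (1 - l) * ip f f"
    using dirichlet_nonneg[of f] by (simp add: dirichlet_eq algebra_simps)
  moreover have "ip f f > 0" using ip_nonneg[of f] ip_eq_0_iff[of f] assms(2,3) by force
  ultimately show ?thesis by (simp add: zero_le_mult_iff)
qed

text \<open>Setting the values outside \<open>{..<N}\<close> to zero makes the unit sphere compact in the product topology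
  on \<open>nat \<Rightarrow> real\<close>.\<close>

lemma compact_centred_sphere:
  "compact {g :: nat \<Rightarrow> real. (\<forall>i. i \<notin> {..<N} \<longrightarrow> g i = 0) \<and> (\<Sum>i<N. g i) = 0 \<and> ip g g = 1}"
    (is "compact ?K")
proof -
  let ?C = "PiE UNIV (\<lambda>_ :: nat. {-1..1 :: real})"
  have "compactin (product_topology (\<lambda>_ :: nat. euclidean) UNIV) ?C"
    by (subst compactin_PiE) (simp add: compactin_euclidean_iff)
  then have C: "compact ?C" by (simp add: euclidean_product_topology)
  have coord: "continuous_on UNIV (\<lambda>g :: nat \<Rightarrow> real. g i)" for i by simp
  let ?K' = "(\<Inter>i\<in>- {..<N}. {g. g i = 0}) \<inter> {g. (\<Sum>i<N. g i) = 0} \<inter> {g. ip g g = 1}"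
  have "closed ?K'"
    unfolding ip_def
    by (intro closed_Int closed_INT ballI closed_Collect_eq continuous_intros coord)
  moreover have "?K' = ?K" by auto
  ultimately have closed: "closed ?K" by simp
  have "?K \<subseteq> ?C"
  proof
    fix g assume g: "g \<in> ?K"
    have "\<bar>g i\<bar> \<le> 1" for i
    proof (cases "i < N")
      case True
      then have "g i * g i \<le> ip g g"
        unfolding ip_def by (intro member_le_sum) auto
      then have "(g i)^2 \<le> 1" using g by (simp add: power2_eq_square)
      then show ?thesis by (simp add: abs_square_le_1)
    qed (use g in simp)
    then show "g \<in> ?C" by (auto simp: PiE_def abs_le_iff minus_le_iff)
  qed
  then have "?C \<inter> ?K = ?K" by (rule Int_absorb1)
  then show ?thesis using compact_Int_closed[OF C closed] by simp
qed

text \<open>A maximiser of the Rayleigh quotient over the functions of sum zero is an eigenvector.\<close>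

lemma centred_eigenvector:
  assumes f: "(\<Sum>i<N. f i) = 0" "ip f f > 0"
  obtains g l where "ip g g = 1" "(\<Sum>i<N. g i) = 0" "\<And>i. i < N \<Longrightarrow> avg g i = l * g i"
    "ip f (avg f) \<le> l * ip f f"
proof -
  let ?K = "{g :: nat \<Rightarrow> real. (\<forall>i. i \<notin> {..<N} \<longrightarrow> g i = 0) \<and> (\<Sum>i<N. g i) = 0 \<and> ip g g = 1}"
  define scaled where "scaled h i = (if i < N then h i / sqrt (ip h h) else 0)" for h :: "nat \<Rightarrow> real" and i
  have scaled: "scaled h \<in> ?K \<and> ip (scaled h) (avg (scaled h)) = ip h (avg h) / ip h h"
    if h: "(\<Sum>i<N. h i) = 0" "ip h h > 0" for h
  proof -
    define r where "r = sqrt (ip h h)"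
    have r: "r * r = ip h h" using h(2) by (simp add: r_def)
    have scaled: "scaled h i = h i / r" if "i < N" for i
      using that by (simp add: scaled_def r_def)
    have "(\<Sum>i<N. scaled h i) = (\<Sum>i<N. h i) / r"
      by (simp add: scaled sum_divide_distrib)
    moreover have "ip (scaled h) (scaled h) = ip h h / (r * r)"
      unfolding ip_def sum_divide_distrib by (simp add: scaled)
    moreover have "avg (scaled h) i = avg h i / r" for i
      by (simp add: avg_def scaled sum_divide_distrib)
    then have "ip (scaled h) (avg (scaled h)) = ip h (avg h) / (r * r)"
      unfolding ip_def sum_divide_distrib by (simp add: scaled)
    ultimately show ?thesis unfolding r using h by (simp add: scaled_def)
  qed
  have cont: "continuous_on X (\<lambda>g. ip g (avg g))" for X
  proof -
    have coord: "continuous_on X (\<lambda>g :: nat \<Rightarrow> real. g i)" for i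
      by (rule continuous_on_subset[of UNIV]) simp_all
    show ?thesis unfolding ip_def avg_def by (intro continuous_intros coord)
  qed
  have "?K \<noteq> {}" using scaled[OF f] by blast
  from continuous_attains_sup[OF compact_centred_sphere this cont]
  obtain g where g: "g \<in> ?K" and max: "\<forall>h\<in>?K. ip h (avg h) \<le> ip g (avg g)" by (elim bexE)
  define l where "l = ip g (avg g)"
  have max': "ip h (avg h) \<le> l * ip h h" if h: "(\<Sum>i<N. h i) = 0" for h
  proof (cases "ip h h = 0")
    case True
    then have "h i = 0" if "i < N" for i using that ip_eq_0_iff by blast
    then have "ip h (avg h) = 0" by (simp add: ip_def)
    then show ?thesis using True by simp
  next
    case False
    then have "ip h h > 0" using ip_nonneg[of h] by simp
    note pos = this
    have "ip (scaled h) (avg (scaled h)) \<le> l"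
      using max[rule_format, of "scaled h"] scaled[OF h pos] unfolding l_def by blast
    then show ?thesis using scaled[OF h pos] pos by (simp add: divide_le_eq)
  qed
  \<comment> \<open>The residual \<open>u\<close> has sum zero as well, so \<open>g\<close> may be varied in its direction.\<close>
  define u where "u i = avg g i - l * g i" for i
  have sum_g: "(\<Sum>i<N. g i) = 0" and gg: "ip g g = 1" using g by auto
  have sum_u: "(\<Sum>i<N. u i) = 0"
    using sum_g by (simp add: u_def sum_subtractf sum_avg flip: sum_distrib_left)
  have "ip u u = 0"
  proof (rule ccontr)
    assume "ip u u \<noteq> 0"
    then have pos: "ip u u > 0" using ip_nonneg[of u] by simp
    define c where "c = l * ip u u - ip u (avg u)"
    have c: "c \<ge> 0" using max'[OF sum_u] by (simp add: c_def)
    have step: "2 * e * ip u u \<le> e ^ 2 * c" for e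
    proof -
      let ?h = "\<lambda>i. g i + e * u i"
      have avg: "avg ?h = (\<lambda>i. avg g i + e * avg u i)"
        by (rule ext) (simp add: avg_def algebra_simps sum.distrib sum_distrib_left)
      have "ip ?h (avg ?h) = ip g (avg g) + e * ip u (avg g) + e * ip g (avg u) + e^2 * ip u (avg u)"
        unfolding avg by (simp add: ip_def algebra_simps sum.distrib sum_distrib_left power2_eq_square)
      also have "ip g (avg u) = ip u (avg g)" using ip_avg[of g u] by (simp add: ip_commute)
      finally have 1: "ip ?h (avg ?h) = l + 2 * e * ip u (avg g) + e^2 * ip u (avg u)"
        by (simp add: l_def)
      have 2: "ip ?h ?h = 1 + 2 * e * ip u g + e^2 * ip u u"
        unfolding gg[symmetric] by (simp add: ip_def algebra_simps sum.distrib sum_distrib_left power2_eq_square)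
      have "(\<Sum>i<N. ?h i) = 0" using sum_g sum_u by (simp add: sum.distrib flip: sum_distrib_left)
      from max'[OF this] have "2 * e * (ip u (avg g) - l * ip u g) \<le> e^2 * c"
        unfolding 1 2 c_def by (simp add: algebra_simps)
      moreover have "ip u (avg g) - l * ip u g = ip u u"
        unfolding ip_def u_def by (simp add: algebra_simps sum_subtractf sum.distrib sum_distrib_left)
      ultimately show ?thesis by simp
    qed
    \<comment> \<open>For small \<open>e\<close> the linear term dominates, which contradicts \<open>step\<close>.\<close>
    define e where "e = ip u u / (c + 1)"
    have e: "e > 0" "e * (c + 1) = ip u u" using pos c by (simp_all add: e_def)
    have "e * (2 * ip u u) \<le> e * (e * c)" using step[of e] by (simp add: power2_eq_square mult_ac)
    then have "2 * ip u u \<le> e * c" using e(1) by simp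
    then show False using e pos by (simp add: algebra_simps)
  qed
  then have "avg g i = l * g i" if "i < N" for i
    using that ip_eq_0_iff[of u] by (simp add: u_def)
  then show ?thesis using that[of g l] gg sum_g max'[OF f(1)] by blast
qed

text \<open>The transition matrix.\<close>

definition walk_matrix :: "real mat" where
  "walk_matrix = Matrix.mat N N (\<lambda>(i, j). P i j)"

lemma walk_matrix_carrier: "walk_matrix \<in> carrier_mat N N"
  by (simp add: walk_matrix_def)

lemma walk_matrix_mult_vec: "i < N \<Longrightarrow> (walk_matrix *\<^sub>v Matrix.vec N f) $ i = avg f i"
  by (simp add: walk_matrix_def avg_def scalar_prod_def atLeast0LessThan)

lemma root_char_poly_iff:
  "poly (char_poly walk_matrix) l = 0 \<longleftrightarrow> (\<exists>f. (\<exists>i<N. f i \<noteq> 0) \<and> (\<forall>i<N. avg f i = l * f i))"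
proof -
  have "poly (char_poly walk_matrix) l = 0 \<longleftrightarrow> (\<exists>v. v \<in> carrier_vec N \<and> v \<noteq> 0\<^sub>v N \<and> walk_matrix *\<^sub>v v = l \<cdot>\<^sub>v v)"
    unfolding eigenvalue_root_char_poly[OF walk_matrix_carrier, symmetric] eigenvalue_def eigenvector_def
    using walk_matrix_carrier by simp
  also have "\<dots> \<longleftrightarrow> (\<exists>f. (\<exists>i<N. f i \<noteq> 0) \<and> (\<forall>i<N. avg f i = l * f i))"
  proof
    assume "\<exists>v. v \<in> carrier_vec N \<and> v \<noteq> 0\<^sub>v N \<and> walk_matrix *\<^sub>v v = l \<cdot>\<^sub>v v"
    then obtain v where v: "v \<in> carrier_vec N" "v \<noteq> 0\<^sub>v N" "walk_matrix *\<^sub>v v = l \<cdot>\<^sub>v v" by blast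
    have veq: "v = Matrix.vec N (($) v)" using v(1) by auto
    have "avg (($) v) i = l * v $ i" if "i < N" for i
      using walk_matrix_mult_vec[OF that, of "($) v"] v(1,3) that unfolding veq[symmetric] by simp
    moreover have "\<exists>i<N. v $ i \<noteq> 0"
    proof (rule ccontr)
      assume "\<not> ?thesis"
      then have "v = 0\<^sub>v N" using v(1) by (intro eq_vecI) auto
      then show False using v(2) by blast
    qed
    ultimately show "\<exists>f. (\<exists>i<N. f i \<noteq> 0) \<and> (\<forall>i<N. avg f i = l * f i)" by blast
  next
    assume "\<exists>f. (\<exists>i<N. f i \<noteq> 0) \<and> (\<forall>i<N. avg f i = l * f i)"
    then obtain f i where f: "i < N" "f i \<noteq> 0" "\<forall>i<N. avg f i = l * f i" by blast
    have "Matrix.vec N f \<noteq> 0\<^sub>v N"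
    proof
      assume "Matrix.vec N f = 0\<^sub>v N"
      then have "Matrix.vec N f $ i = 0\<^sub>v N $ i" by simp
      then show False using f(1,2) by simp
    qed
    moreover have "walk_matrix *\<^sub>v Matrix.vec N f = l \<cdot>\<^sub>v Matrix.vec N f"
      using f(3) walk_matrix_carrier walk_matrix_mult_vec by (intro eq_vecI) (simp_all del: index_mult_mat_vec)
    ultimately show "\<exists>v. v \<in> carrier_vec N \<and> v \<noteq> 0\<^sub>v N \<and> walk_matrix *\<^sub>v v = l \<cdot>\<^sub>v v"
      by (intro exI[of _ "Matrix.vec N f"]) simp
  qed
  finally show ?thesis .
qed

text \<open>In the basis consisting of the constant vector and the last \<open>N - 1\<close> unit vectors the matrix is block triangular with
  diagonal blocks \<open>1\<close> and \<open>D\<close>. If \<open>1\<close> were an eigenvalue of \<open>D\<close>, there would be a nonzero function \<open>g\<close> with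
  \<open>g 0 = 0\<close> such that \<open>avg g - g\<close> is constant. This constant is \<open>0\<close> since \<open>avg\<close> preserves sums, so \<open>g\<close> is
  harmonic and hence constant, which is a contradiction.\<close>

lemma order_1_char_poly:
  assumes "N > 0"
  shows "order 1 (char_poly walk_matrix) = 1"
proof -
  obtain m where N: "N = Suc m" using assms by (cases N) auto
  define B\<^sub>1 where "B\<^sub>1 = Matrix.mat 1 1 (\<lambda>_. 1 :: real)"
  define B\<^sub>2 where "B\<^sub>2 = Matrix.mat 1 m (\<lambda>(_, j). P 0 (Suc j))"
  define D where "D = Matrix.mat m m (\<lambda>(i, j). P (Suc i) (Suc j) - P 0 (Suc j))"
  define B where "B = four_block_mat B\<^sub>1 B\<^sub>2 (0\<^sub>m m 1) D"
  define S where "S = Matrix.mat N N (\<lambda>(i, j). if i = j \<or> j = 0 then 1 else 0 :: real)"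
  define S' where "S' = Matrix.mat N N (\<lambda>(i, j). if i = j then 1 else if j = 0 then - 1 else 0 :: real)"
  have carr: "B\<^sub>1 \<in> carrier_mat 1 1" "B\<^sub>2 \<in> carrier_mat 1 m" "D \<in> carrier_mat m m"
    "S \<in> carrier_mat N N" "S' \<in> carrier_mat N N"
    by (simp_all add: B\<^sub>1_def B\<^sub>2_def D_def S_def S'_def)
  have "B \<in> carrier_mat N N"
    unfolding B_def N using four_block_carrier_mat[OF carr(1,3)] by simp
  note carr = carr this
  have sumS: "(\<Sum>k<N. (if i = k \<or> k = 0 then 1 else 0) * h k) = h 0 + (if i = 0 then 0 else h i)"
    if "i < N" for i and h :: "nat \<Rightarrow> real"
  proof -
    have "(\<Sum>k<N. (if i = k \<or> k = 0 then 1 else 0) * h k) =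
      (\<Sum>k<N. (if k = 0 then h k else 0) + (if k = i then if i = 0 then 0 else h i else 0))"
      by (intro sum.cong) auto
    also have "\<dots> = h 0 + (if i = 0 then 0 else h i)"
      using that by (simp add: sum.distrib sum.delta)
    finally show ?thesis .
  qed
  have entry: "(X * Y) $$ (i, j) = (\<Sum>k<N. X $$ (i, k) * Y $$ (k, j))"
    if "X \<in> carrier_mat N N" "Y \<in> carrier_mat N N" "i < N" "j < N" for X Y :: "real mat" and i j
    using that by (simp add: scalar_prod_def atLeast0LessThan)
  have SB: "(S * B) $$ (i, j) = (if j = 0 then 1 else P i j)" if "i < N" "j < N" for i j
  proof -
    have "(S * B) $$ (i, j) = (\<Sum>k<N. (if i = k \<or> k = 0 then 1 else 0) * B $$ (k, j))"
      using that carr by (simp add: S_def scalar_prod_def atLeast0LessThan)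
    also have "\<dots> = B $$ (0, j) + (if i = 0 then 0 else B $$ (i, j))"
      by (rule sumS[OF that(1)])
    also have "\<dots> = (if j = 0 then 1 else P i j)"
      using that carr unfolding B_def N by (auto simp: B\<^sub>1_def B\<^sub>2_def D_def)
    finally show ?thesis .
  qed
  have SB_carr: "S * B \<in> carrier_mat N N" using carr by simp
  have "walk_matrix = S * B * S'"
  proof (rule eq_matI)
    fix i j assume "i < dim_row (S * B * S')" "j < dim_col (S * B * S')"
    then have ij: "i < N" "j < N" using carr by simp_all
    have "(S * B * S') $$ (i, j) = (\<Sum>k<N. (S * B) $$ (i, k) * S' $$ (k, j))"
      by (rule entry) (use ij carr SB_carr in simp_all)
    also have "\<dots> = (\<Sum>k<N. (if k = 0 then 1 else P i k) * (if k = j then 1 else if j = 0 then - 1 else 0))"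
      using ij by (intro sum.cong) (simp_all add: SB S'_def)
    also have "\<dots> = P i j"
    proof (cases "j = 0")
      case True
      then have "(\<Sum>k<N. (if k = 0 then 1 else P i k) * (if k = j then 1 else if j = 0 then - 1 else 0))
          = 1 - (\<Sum>k<m. P i (Suc k))"
        unfolding N by (simp add: sum.lessThan_Suc_shift sum_negf del: sum.lessThan_Suc)
      also have "\<dots> = P i 0"
        using P_row_sum[OF ij(1)] unfolding N by (simp add: sum.lessThan_Suc_shift del: sum.lessThan_Suc)
      finally show ?thesis using True by simp
    next
      case False
      then have "(\<Sum>k<N. (if k = 0 then 1 else P i k) * (if k = j then 1 else if j = 0 then - 1 else 0))
          = (\<Sum>k<N. if k = j then P i j else 0)"
        by (intro sum.cong) auto
      then show ?thesis using ij by simp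
    qed
    finally show "walk_matrix $$ (i, j) = (S * B * S') $$ (i, j)" using ij by (simp add: walk_matrix_def)
  qed (use carr walk_matrix_carrier in simp_all)
  moreover have "S * S' = 1\<^sub>m N"
  proof (rule eq_matI)
    fix i j assume "i < dim_row (1\<^sub>m N :: real mat)" "j < dim_col (1\<^sub>m N :: real mat)"
    then have ij: "i < N" "j < N" by simp_all
    have "(S * S') $$ (i, j) = (\<Sum>k<N. (if i = k \<or> k = 0 then 1 else 0) * S' $$ (k, j))"
      using ij carr by (simp add: S_def scalar_prod_def atLeast0LessThan)
    also have "\<dots> = S' $$ (0, j) + (if i = 0 then 0 else S' $$ (i, j))"
      by (rule sumS[OF ij(1)])
    finally show "(S * S') $$ (i, j) = 1\<^sub>m N $$ (i, j)"
      using ij N by (auto simp: S'_def)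
  qed (use carr in simp_all)
  moreover from this have "S' * S = 1\<^sub>m N"
    using mat_mult_left_right_inverse carr by blast
  ultimately have "similar_mat_wit walk_matrix B S S'"
    using carr walk_matrix_carrier by (intro similar_mat_witI) auto
  then have "char_poly walk_matrix = char_poly B"
    by (intro char_poly_similar) (auto simp: similar_mat_def)
  also have "\<dots> = char_poly B\<^sub>1 * char_poly D"
    unfolding B_def by (rule char_poly_four_block_zeros_col) (rule carr)+
  also have "char_poly B\<^sub>1 = [:- 1, 1:]"
    unfolding B\<^sub>1_def char_poly_defs by (simp add: det_single)
  finally have char_poly: "char_poly walk_matrix = [:- 1, 1:] * char_poly D" .
  have "poly (char_poly D) 1 \<noteq> 0"
  proof
    assume "poly (char_poly D) 1 = 0"
    then obtain w where w: "w \<in> carrier_vec m" "w \<noteq> 0\<^sub>v m" "D *\<^sub>v w = w"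
      unfolding eigenvalue_root_char_poly[OF carr(3), symmetric] eigenvalue_def eigenvector_def
      using carr(3) by auto
    define g where "g i = (case i of 0 \<Rightarrow> 0 | Suc j \<Rightarrow> w $ j)" for i
    have g: "avg g (Suc i) = g (Suc i) + avg g 0" if "i < m" for i
    proof -
      have "g (Suc i) = (D *\<^sub>v w) $ i" using w(3) by (simp add: g_def)
      also have "\<dots> = (\<Sum>j<m. (P (Suc i) (Suc j) - P 0 (Suc j)) * w $ j)"
        using that w(1) by (simp add: D_def scalar_prod_def atLeast0LessThan)
      also have "\<dots> = avg g (Suc i) - avg g 0"
        unfolding avg_def unfolding N by (simp add: sum.lessThan_Suc_shift g_def algebra_simps sum_subtractf del: sum.lessThan_Suc)
      finally show ?thesis by simp
    qed
    have eq: "avg g i = g i + avg g 0" if "i < N" for i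
      using that g by (cases i) (simp_all add: N g_def)
    have "(\<Sum>i<N. avg g i) = (\<Sum>i<N. g i + avg g 0)"
      by (rule sum.cong[OF refl]) (rule eq, simp)
    then have "avg g 0 = 0" using assms by (simp add: sum_avg sum.distrib)
    then have "avg g i = g i" if "i < N" for i using eq[OF that] by simp
    then have "g i = g 0" if "i < N" for i
      using harmonic_constant[of g i 0] that assms by blast
    then have "w $ i = 0" if "i < m" for i using that by (force simp: g_def N)
    then have "w = 0\<^sub>v m" using w(1) by (intro eq_vecI) auto
    then show False using w(2) by blast
  qed
  then have "order 1 (char_poly D) = 0" by (rule order_0I)
  moreover have "char_poly walk_matrix \<noteq> 0"
    using degree_monic_char_poly[OF walk_matrix_carrier] by auto
  moreover have "order (1::real) [:- 1, 1:] = 1"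
    using order_power_n_n[of "1::real" 1] by simp
  ultimately show ?thesis
    unfolding char_poly by (subst order_mult) auto
qed

text \<open>The gap is positive and obeys the variational upper bound for every test function of sum zero. The
  existence of such a function other than \<open>0\<close> also provides the second entry of the list of eigenvalues.\<close>

theorem spectral_gap_bounds:
  assumes f: "(\<Sum>i<N. f i) = 0" "ip f f > 0"
  shows "0 < spectral_gap walk_matrix" "spectral_gap walk_matrix * ip f f \<le> dirichlet f"
proof -
  obtain g l where g: "ip g g = 1" "(\<Sum>i<N. g i) = 0" "\<And>i. i < N \<Longrightarrow> avg g i = l * g i"
    and l: "ip f (avg f) \<le> l * ip f f"
    using centred_eigenvector[OF f] by blast
  have "\<not> (\<forall>i<N. g i = 0)" using ip_eq_0_iff[of g] g(1) by simp
  then obtain i where i: "i < N" "g i \<noteq> 0" by blast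
  have "l \<noteq> 1"
  proof
    assume "l = 1"
    then have "g j = g i" if "j < N" for j using harmonic_constant[of g j i] g(3) that i by simp
    then have "(\<Sum>j<N. g j) = (\<Sum>j<N. g i)" by (intro sum.cong) simp_all
    then show False using g(2) i by simp
  qed
  then have less: "l < 1" using eigenvalue_le_1[OF g(3) i] by simp
  have nz: "char_poly walk_matrix \<noteq> 0" using degree_monic_char_poly[OF walk_matrix_carrier] by auto
  have "count (proots (char_poly walk_matrix)) 1 = 1" using order_1_char_poly i(1) nz by simp
  moreover have "x \<le> 1" if "x \<in># proots (char_poly walk_matrix)" for x
    using that eigenvalue_le_1 nz by (auto simp: root_char_poly_iff)
  moreover have "l \<in># proots (char_poly walk_matrix)"
    using nz i g(3) by (auto simp: root_char_poly_iff)
  ultimately have "l \<le> eigenvalues_desc walk_matrix ! 1" "eigenvalues_desc walk_matrix ! 1 < 1"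
    unfolding eigenvalues_desc_def using second_largest less by blast+
  then have "l * ip f f \<le> eigenvalues_desc walk_matrix ! 1 * ip f f"
    using f(2) by (intro mult_right_mono) simp_all
  then show "spectral_gap walk_matrix * ip f f \<le> dirichlet f"
    using l by (simp add: spectral_gap_def dirichlet_eq left_diff_distrib)
  show "0 < spectral_gap walk_matrix"
    using \<open>eigenvalues_desc walk_matrix ! 1 < 1\<close> by (simp add: spectral_gap_def)
qed

end

section \<open>The relaxation time of the edge-flip chain\<close>

lemma vflip_neq: "vflip T T' \<Longrightarrow> T \<noteq> T'"
proof (erule vflipE)
  fix X p q
  assume T: "T = X \<union> {(p @ [False], q), (p @ [True], q)}" "T' = X \<union> {(p, q @ [False]), (p, q @ [True])}"
    "X \<inter> {(p @ [False], q), (p @ [True], q), (p, q @ [False]), (p, q @ [True])} = {}"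
  have "(p @ [False], q) \<in> T" unfolding T(1) by simp
  moreover have "(p @ [False], q) \<notin> T'" using T(3) unfolding T(2) by simp
  ultimately show "T \<noteq> T'" by blast
qed

text \<open>The tiling with index \<open>i\<close> in the enumeration that underlies the transition matrix, as a set of tiles.\<close>

definition state :: "nat \<Rightarrow> nat \<Rightarrow> tile set" where
  "state k i = rect -` from_nat_into (dyadic_tilings k) i"

text \<open>The entries of the transition matrix.\<close>

definition step :: "nat \<Rightarrow> nat \<Rightarrow> nat \<Rightarrow> real" where
  "step k i j = pmf (edge_flip_chain k (from_nat_into (dyadic_tilings k) i))
     (from_nat_into (dyadic_tilings k) j)"

lemma finite_dyadic_tilings: "finite (dyadic_tilings k)"
  by (simp add: dyadic_tilings_eq finite_tilings)

lemma card_dyadic_tilings: "card (dyadic_tilings k) = card (tilings k)"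
  unfolding dyadic_tilings_eq by (rule card_image) (simp add: inj_on_def)

lemma vimage_rect_image [simp]: "rect -` rect ` T = T"
  by (rule inj_vimage_image_eq) (rule inj_rect)

lemma bij_betw_state: "bij_betw (state k) {..<card (tilings k)} (tilings k)"
proof -
  have "bij_betw ((-`) rect) (dyadic_tilings k) (tilings k)"
    by (rule bij_betw_byWitness[where f' = "(`) rect"]) (auto simp: dyadic_tilings_eq)
  from bij_betw_trans[OF bij_betw_from_nat_into_finite[OF finite_dyadic_tilings] this]
  show ?thesis unfolding card_dyadic_tilings by (simp add: state_def[abs_def] comp_def)
qed

lemma state_mem: "i < card (tilings k) \<Longrightarrow> state k i \<in> tilings k"
  using bij_betw_apply[OF bij_betw_state] by simp

lemma from_nat_into_dyadic_tilings:
  assumes "i < card (tilings k)"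
  shows "from_nat_into (dyadic_tilings k) i = rect ` state k i"
proof -
  have "from_nat_into (dyadic_tilings k) i \<in> dyadic_tilings k"
    using bij_betw_apply[OF bij_betw_from_nat_into_finite[OF finite_dyadic_tilings], of i k] assms
    by (simp add: card_dyadic_tilings)
  then show ?thesis unfolding state_def dyadic_tilings_eq by auto
qed

lemma sum_states: "(\<Sum>i<card (tilings k). g (state k i)) = (\<Sum>T\<in>tilings k. g T)"
  using bij_betw_state by (rule sum.reindex_bij_betw)

lemma step_eq:
  assumes "i < card (tilings k)" "j < card (tilings k)"
  shows "step k i j = pmf (edge_flip_chain k (rect ` state k i)) (rect ` state k j)"
  using assms by (simp add: step_def from_nat_into_dyadic_tilings)

lemma symmetric_walk_edge_flip: "symmetric_walk (card (tilings k)) (step k)"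
proof
  let ?N = "card (tilings k)"
  fix i j assume ij: "i < ?N" "j < ?N"
  show "0 \<le> step k i j" by (simp add: step_def)
  show "step k i j = step k j i"
  proof (cases "state k i = state k j")
    case True
    then show ?thesis by (simp add: step_eq ij)
  next
    case False
    then show ?thesis
      using pmf_edge_flip_chain[OF state_mem[OF ij(1)] state_mem[OF ij(2)]]
        pmf_edge_flip_chain[OF state_mem[OF ij(2)] state_mem[OF ij(1)]]
      by (simp add: step_eq ij add.commute)
  qed
  show "(i, j) \<in> {(i, j). i < ?N \<and> j < ?N \<and> 0 < step k i j}\<^sup>*"
  proof -
    let ?index = "inv_into {..<?N} (state k)"
    have index: "?index T < ?N" "state k (?index T) = T" if "T \<in> tilings k" for T
    proof -
      have T: "T \<in> state k ` {..<?N}" using bij_betw_state[of k] that by (simp add: bij_betw_def)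
      show "?index T < ?N" using inv_into_into[OF T] by simp
      show "state k (?index T) = T" by (rule f_inv_into_f[OF T])
    qed
    have "(?index T, ?index T') \<in> {(i, j). i < ?N \<and> j < ?N \<and> 0 < step k i j}"
      if "(T, T') \<in> flip_rel k" for T T'
    proof -
      have mem: "T \<in> tilings k" "T' \<in> tilings k" and flip: "vflip T T' \<or> vflip T' T"
        using that by (simp_all add: flip_rel_def)
      then have "T' \<noteq> T" using vflip_neq by blast
      then show ?thesis
        using flip index[OF mem(1)] index[OF mem(2)] pmf_edge_flip_chain[OF mem]
        by (auto simp: step_eq)
    qed
    from rtrancl_image[OF flip_rel_connected[OF state_mem[OF ij(1)] state_mem[OF ij(2)]] this]
    have "(?index (state k i), ?index (state k j)) \<in> {(i, j). i < ?N \<and> j < ?N \<and> 0 < step k i j}\<^sup>*" .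
    then show ?thesis
      using ij bij_betw_state[of k] by (simp add: bij_betw_def inv_into_f_f)
  qed
next
  fix i assume i: "i < card (tilings k)"
  have mem: "rect ` state k i \<in> dyadic_tilings k" using state_mem[OF i] by simp
  have "(\<Sum>j<card (tilings k). step k i j) =
      (\<Sum>j<card (tilings k). pmf (edge_flip_chain k (rect ` state k i)) (rect ` state k j))"
    using i by (intro sum.cong) (simp_all add: step_eq)
  also have "\<dots> = (\<Sum>T\<in>tilings k. pmf (edge_flip_chain k (rect ` state k i)) (rect ` T))"
    by (rule sum_states)
  also have "\<dots> = (\<Sum>D\<in>dyadic_tilings k. pmf (edge_flip_chain k (rect ` state k i)) D)"
    unfolding dyadic_tilings_eq by (subst sum.reindex) (simp_all add: inj_on_def)
  also have "\<dots> = 1"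
    by (rule sum_pmf_eq_1[OF finite_dyadic_tilings set_pmf_edge_flip_chain[OF mem]])
  finally show "(\<Sum>j<card (tilings k). step k i j) = 1" .
qed

lemma transition_matrix_eq:
  "transition_matrix (dyadic_tilings k) (edge_flip_chain k) = symmetric_walk.walk_matrix (card (tilings k)) (step k)"
  unfolding transition_matrix_def symmetric_walk.walk_matrix_def[OF symmetric_walk_edge_flip] card_dyadic_tilings step_def ..

text \<open>The flow out of \<open>vcut k\<close>, where every state has weight \<open>1\<close>.\<close>

lemma vcut_flow:
  "(\<Sum>T\<in>tilings (Suc k). \<Sum>T'\<in>tilings (Suc k).
      pmf (edge_flip_chain (Suc k) (rect ` T)) (rect ` T') * of_bool (T \<in> vcut k \<and> T' \<notin> vcut k))
    \<le> num_tilings k ^ 2 / (2 * golden_ratio ^ (2 * k))" (is "?flow \<le> _")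
proof -
  let ?B = "{(T, T'). (T, T') \<in> flip_rel (Suc k) \<and> T \<in> vcut k \<and> T' \<notin> vcut k}"
  let ?S = "tilings (Suc k)"
  have fin: "finite (?S \<times> ?S)" by (simp add: finite_tilings)
  have "?flow \<le> (\<Sum>T\<in>?S. \<Sum>T'\<in>?S. of_bool ((T, T') \<in> ?B) / 2 ^ Suc k)"
  proof (intro sum_mono)
    fix T T' assume mem: "T \<in> ?S" "T' \<in> ?S"
    show "pmf (edge_flip_chain (Suc k) (rect ` T)) (rect ` T') * of_bool (T \<in> vcut k \<and> T' \<notin> vcut k)
        \<le> of_bool ((T, T') \<in> ?B) / 2 ^ Suc k"
    proof (cases "T \<in> vcut k \<and> T' \<notin> vcut k")
      case True
      then have "T' \<noteq> T" by blast
      have "(of_bool a + of_bool b) / (2 * 2 ^ Suc k) \<le> (of_bool (a \<or> b) / 2 ^ Suc k :: real)" for a b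
        by (cases a; cases b) (simp_all add: divide_right_mono divide_left_mono)
      then show ?thesis
        using True mem pmf_edge_flip_chain[OF mem \<open>T' \<noteq> T\<close>] by (simp add: flip_rel_def)
    next
      case False
      then show ?thesis by auto
    qed
  qed
  also have "\<dots> = (\<Sum>m\<in>?S \<times> ?S. of_bool (m \<in> ?B)) / 2 ^ Suc k"
    by (simp only: sum.cartesian_product case_prod_unfold sum_divide_distrib prod.collapse)
  also have "(\<Sum>m\<in>?S \<times> ?S. of_bool (m \<in> ?B)) = real (card ((?S \<times> ?S) \<inter> ?B))"
    by (subst sum_of_bool_eq) (simp_all add: fin Int_def)
  also have "(?S \<times> ?S) \<inter> ?B = ?B" by (auto simp: flip_rel_def)
  finally have flow: "?flow \<le> real (card ?B) / 2 ^ Suc k" .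
  have pos: "golden_ratio ^ (2 * k) > 0" using golden_ratio_gt_1 by simp
  have "real (card ?B) \<le> 2 ^ k * num_tilings k ^ 2 / golden_ratio ^ (2 * k)"
    using card_boundary_pairs[of k] pos by (simp add: field_simps)
  then have "real (card ?B) / 2 ^ Suc k \<le> 2 ^ k * num_tilings k ^ 2 / golden_ratio ^ (2 * k) / 2 ^ Suc k"
    by (rule divide_right_mono) simp
  also have "\<dots> = num_tilings k ^ 2 / (2 * golden_ratio ^ (2 * k))" by simp
  finally show ?thesis using flow by simp
qed

text \<open>The test function \<open>F\<close> is the indicator of \<open>vcut k\<close> minus its mean.\<close>

lemma spectral_gap_edge_flip:
  defines "A k \<equiv> transition_matrix (dyadic_tilings k) (edge_flip_chain k)"
  shows "0 < spectral_gap (A (Suc k))" "spectral_gap (A (Suc k)) \<le> golden_ratio ^ 2 / (2 * golden_ratio ^ (2 * k))"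
proof -
  let ?S = "tilings (Suc k)" and ?N = "num_tilings (Suc k)" and ?v = "num_tilings k ^ 2"
  interpret walk: symmetric_walk "card ?S" "step (Suc k)" by (rule symmetric_walk_edge_flip)
  have A: "A (Suc k) = walk.walk_matrix" unfolding A_def by (rule transition_matrix_eq)
  have v: "?v > 0" using finite_tilings tilings_nonempty by (simp add: card_gt_0_iff)
  have N: "golden_ratio * ?v \<le> ?N" by (rule num_tilings_Suc_ge)
  have "0 < golden_ratio * ?v" using v golden_ratio_gt_1 by simp
  then have Npos: "?N > 0" using N by linarith
  define F where "F T = of_bool (T \<in> vcut k) - ?v / ?N" for T
  define f where "f i = F (state (Suc k) i)" for i
  have vcut: "(\<Sum>T\<in>?S. of_bool (T \<in> vcut k)) = ?v"
  proof -
    have "?S \<inter> {T. T \<in> vcut k} = vcut k" by (auto simp: tilings_Suc)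
    then show ?thesis by (simp add: sum_of_bool_eq finite_tilings card_vcut)
  qed
  have "(\<Sum>i<card ?S. f i) = (\<Sum>T\<in>?S. F T)" unfolding f_def by (rule sum_states)
  also have "\<dots> = 0" using vcut Npos by (simp add: F_def sum_subtractf)
  finally have centred: "(\<Sum>i<card ?S. f i) = 0" .
  have "walk.ip f f = (\<Sum>T\<in>?S. F T * F T)" unfolding walk.ip_def f_def by (rule sum_states)
  also have "\<dots> = (\<Sum>T\<in>?S. of_bool (T \<in> vcut k) * (1 - 2 * (?v / ?N)) + (?v / ?N)^2)"
    by (intro sum.cong) (auto simp: F_def power2_eq_square algebra_simps)
  also have "\<dots> = ?v * (1 - 2 * (?v / ?N)) + ?N * (?v / ?N)^2"
    unfolding sum.distrib sum_distrib_right[symmetric] vcut by simp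
  also have "\<dots> = ?v * (1 - ?v / ?N)"
    using Npos by (simp add: power2_eq_square field_simps)
  finally have ip: "walk.ip f f = ?v * (1 - ?v / ?N)" .
  have inv: "1 - 1 / golden_ratio = 1 / golden_ratio ^ 2"
    using golden_ratio_gt_1 golden_ratio_square by (simp add: field_simps power2_eq_square)
  have "?v / ?N \<le> 1 / golden_ratio"
    using N Npos golden_ratio_gt_1 by (simp add: field_simps)
  then have "1 / golden_ratio ^ 2 \<le> 1 - ?v / ?N" unfolding inv[symmetric] by simp
  then have ip_ge: "?v * (1 / golden_ratio ^ 2) \<le> walk.ip f f"
    unfolding ip using v by (intro mult_left_mono) simp_all
  moreover have "0 < ?v * (1 / golden_ratio ^ 2)" using v golden_ratio_gt_1 by simp
  ultimately have ip_pos: "walk.ip f f > 0" by linarith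
  note bounds = walk.spectral_gap_bounds[OF centred ip_pos, folded A]
  show pos: "0 < spectral_gap (A (Suc k))" by (rule bounds(1))
  let ?p = "\<lambda>T T'. pmf (edge_flip_chain (Suc k) (rect ` T)) (rect ` T')"
  let ?out = "\<lambda>T T'. of_bool (T \<in> vcut k \<and> T' \<notin> vcut k) :: real"
  have p_sym: "?p T T' = ?p T' T" if "T \<in> ?S" "T' \<in> ?S" for T T'
    using pmf_edge_flip_chain[OF that] pmf_edge_flip_chain[OF that(2,1)]
    by (cases "T = T'") (simp_all add: add.commute)
  have "2 * walk.dirichlet f = (\<Sum>i<card ?S. \<Sum>j<card ?S. ?p (state (Suc k) i) (state (Suc k) j) * (F (state (Suc k) i) - F (state (Suc k) j))^2)"
    unfolding walk.dirichlet_def by (simp add: step_eq f_def)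
  also have "\<dots> = (\<Sum>T\<in>?S. \<Sum>T'\<in>?S. ?p T T' * (F T - F T')^2)"
    unfolding sum_states[where g = "\<lambda>T'. ?p (state (Suc k) _) T' * (F (state (Suc k) _) - F T')^2"]
    by (rule sum_states[where g = "\<lambda>T. \<Sum>T'\<in>?S. ?p T T' * (F T - F T')^2"])
  also have "\<dots> = (\<Sum>T\<in>?S. \<Sum>T'\<in>?S. ?p T T' * ?out T T') + (\<Sum>T\<in>?S. \<Sum>T'\<in>?S. ?p T T' * ?out T' T)"
    unfolding sum.distrib[symmetric] by (intro sum.cong) (auto simp: F_def)
  also have "(\<Sum>T\<in>?S. \<Sum>T'\<in>?S. ?p T T' * ?out T' T) = (\<Sum>T'\<in>?S. \<Sum>T\<in>?S. ?p T T' * ?out T' T)"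
    by (rule sum.swap)
  also have "\<dots> = (\<Sum>T\<in>?S. \<Sum>T'\<in>?S. ?p T T' * ?out T T')"
    using p_sym by (intro sum.cong) auto
  finally have "walk.dirichlet f \<le> ?v / (2 * golden_ratio ^ (2 * k))"
    using vcut_flow[of k] by simp
  then have "spectral_gap (A (Suc k)) * (?v * (1 / golden_ratio ^ 2)) \<le> ?v / (2 * golden_ratio ^ (2 * k))"
    using bounds(2) mult_left_mono[OF ip_ge less_imp_le[OF pos]] by linarith
  then have "?v * (spectral_gap (A (Suc k)) / golden_ratio ^ 2) \<le> ?v * (1 / (2 * golden_ratio ^ (2 * k)))"
    by (simp add: mult_ac)
  then have "spectral_gap (A (Suc k)) / golden_ratio ^ 2 \<le> 1 / (2 * golden_ratio ^ (2 * k))"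
    using v by (simp only: mult_le_cancel_left_pos)
  then show "spectral_gap (A (Suc k)) \<le> golden_ratio ^ 2 / (2 * golden_ratio ^ (2 * k))"
    using golden_ratio_gt_1 by (simp add: pos_divide_le_eq)
qed

theorem theorem1p2:
  shows "(\<lambda>k. relaxation_time (transition_matrix (dyadic_tilings k) (edge_flip_chain k)))
           \<in> \<Omega>(\<lambda>k. real (2 ^ k) powr (2 * log 2 golden_ratio))"
proof (rule landau_omega.bigI)
  let ?c = "2 / golden_ratio ^ 4"
  show "?c > 0" using golden_ratio_gt_1 by simp
  show "\<forall>\<^sub>F k in at_top. norm (relaxation_time (transition_matrix (dyadic_tilings k) (edge_flip_chain k)))
      \<ge> ?c * norm (real (2 ^ k) powr (2 * log 2 golden_ratio))"
    using eventually_ge_at_top[of 1]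
  proof eventually_elim
    fix k :: nat assume "k \<ge> 1"
    then obtain m where k: "k = Suc m" by (cases k) auto
    let ?gap = "spectral_gap (transition_matrix (dyadic_tilings k) (edge_flip_chain k))"
    have pos: "golden_ratio > 0" using golden_ratio_gt_1 by simp
    have "real (2 ^ k) powr (2 * log 2 golden_ratio) = (2 powr real k) powr (2 * log 2 golden_ratio)"
      by (simp add: powr_realpow)
    also have "\<dots> = (2 powr log 2 golden_ratio) powr real (2 * k)"
      by (simp add: powr_powr mult_ac)
    also have "\<dots> = golden_ratio ^ (2 * k)"
      using pos by (simp only: powr_log_cancel powr_realpow)
    finally have power: "real (2 ^ k) powr (2 * log 2 golden_ratio) = golden_ratio ^ (2 * k)" .
    have gap: "0 < ?gap" "?gap \<le> golden_ratio ^ 2 / (2 * golden_ratio ^ (2 * m))"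
      unfolding k by (rule spectral_gap_edge_flip)+
    have split: "golden_ratio ^ (2 * k) = golden_ratio ^ 2 * golden_ratio ^ (2 * m)"
      "golden_ratio ^ 4 = golden_ratio ^ 2 * golden_ratio ^ 2"
      by (simp_all add: k flip: power_add)
    have "?c * golden_ratio ^ (2 * k) = 1 / (golden_ratio ^ 2 / (2 * golden_ratio ^ (2 * m)))"
      unfolding split using pos by (simp add: field_simps)
    also have "\<dots> \<le> 1 / ?gap"
      using gap pos by (intro divide_left_mono) simp_all
    finally show "norm (relaxation_time (transition_matrix (dyadic_tilings k) (edge_flip_chain k)))
      \<ge> ?c * norm (real (2 ^ k) powr (2 * log 2 golden_ratio))"
      using gap(1) pos unfolding power by (simp add: relaxation_time_def)
  qed
qed

end
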